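(* Let $n\ge3$. There exists a constant $C_n>0$ depending only on $n$ such that for any $R>0$ and all $u\in C_c^\infty(B_R^+)$, $$\int_{B_R^+}|\nabla u|^2dx\ \ge\ \frac{n^2}{4}\int_{B_R^+}\frac{u^2}{|x|^2}dx+\frac{1}{16R^{1/2}}\int_{B_R^+}\frac{u^2}{|x|^{3/2}}dx+C_n\Big(\int_{B_R^+}X_1^{\frac{2n-2}{n-2}}|u|^{\frac{2n}{n-2}}dx\Big)^{\frac{n-2}{n}},$$ where $X_1=X_1(|x|/R)$.
   Context: $B_R^+=\{x\in\mathbb{R}^n:\ |x|<R,\ x_n>0\}$. $X_1(t)=\frac{1}{1-\ln t}$ for $t\in(0,1)$. *)

theory Defs
  imports "HOL-Analysis.Analysis"
begin

definition partial_deriv :: "'n \<Rightarrow> (real ^ 'n \<Rightarrow> real) \<Rightarrow> real ^ 'n \<Rightarrow> real" where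
  "partial_deriv i u x = frechet_derivative u (at x) (axis i 1)"

definition grad :: "(real ^ 'n \<Rightarrow> real) \<Rightarrow> real ^ 'n \<Rightarrow> real ^ 'n" where
  "grad u x = (\<chi> i. partial_deriv i u x)"

lemma GDERIV_grad:
  fixes u :: "real ^ 'n \<Rightarrow> real"
  assumes "u differentiable (at x)"
  shows "GDERIV u x :> grad u x"
proof -
  have D: "(u has_derivative frechet_derivative u (at x)) (at x)"
    using assms by (simp add: frechet_derivative_works)
  interpret linear "frechet_derivative u (at x)"
    using D by (rule has_derivative_linear)
  have "frechet_derivative u (at x) h = h \<bullet> grad u x" for h
  proof -
    have "frechet_derivative u (at x) h
        = frechet_derivative u (at x) (\<Sum>i\<in>UNIV. h $ i *\<^sub>R axis i 1)"
      using basis_expansion[of h] by (simp add: scalar_mult_eq_scaleR)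
    also have "\<dots> = h \<bullet> grad u x"
      by (simp add: sum scale grad_def partial_deriv_def inner_vec_def)
    finally show ?thesis .
  qed
  then have "frechet_derivative u (at x) = (\<lambda>h. h \<bullet> grad u x)"
    by (rule ext)
  then show ?thesis
    using D by (simp add: gderiv_def)
qed

text \<open>
  \<open>C_diff m u\<close>: the function \<open>u\<close> is of class \<open>C\<^sup>m\<close> on the whole space, i.e. all iterated
  partial derivatives up to order \<open>m\<close> exist and are continuous.
\<close>

primrec C_diff :: "nat \<Rightarrow> (real ^ 'n \<Rightarrow> real) \<Rightarrow> bool" where
  "C_diff 0 u \<longleftrightarrow> continuous_on UNIV u"
| "C_diff (Suc m) u \<longleftrightarrow>
     (\<forall>x. u differentiable (at x)) \<and> (\<forall>i. C_diff m (partial_deriv i u))"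

definition smooth :: "(real ^ 'n \<Rightarrow> real) \<Rightarrow> bool" where
  "smooth u \<longleftrightarrow> (\<forall>m. C_diff m u)"

text \<open>
  A function in \<open>C\<^sub>c\<^sup>\<infinity>(\<Omega>)\<close> is represented by its extension by zero to the whole space: a smooth
  function whose support is a compact subset of \<open>\<Omega>\<close>.
\<close>

definition test_functions :: "(real ^ 'n) set \<Rightarrow> (real ^ 'n \<Rightarrow> real) set" where
  "test_functions \<Omega> =
     {u. smooth u \<and> compact (closure {x. u x \<noteq> 0}) \<and> closure {x. u x \<noteq> 0} \<subseteq> \<Omega>}"

text \<open>
  The index \<open>k\<close> names the coordinate that is required to be positive, since a finite index type
  carries no distinguished last element.
\<close>

definition half_ball :: "'n \<Rightarrow> real \<Rightarrow> (real ^ 'n) set" where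
  "half_ball k R = {x. norm x < R \<and> x $ k > 0}"

definition X1 :: "real \<Rightarrow> real" where
  "X1 t = 1 / (1 - ln t)"

end

theory Submission
  imports Defs
begin

text \<open>
  Write \<open>r = |x|\<close>, \<open>s = ln (R / r) > 0\<close>, so that \<open>X\<^sub>1 = 1 / (1 + s)\<close>, and let the \<^emph>\<open>Hardy deficit\<close> of
  \<open>u\<close> be \<open>H = \<integral>|\<nabla>u|\<^sup>2 - n\<^sup>2/4 \<integral>u\<^sup>2/r\<^sup>2\<close>. The theorem follows from two bounds: the remainder term with
  weight \<open>r powr (-3/2)\<close> is at most \<open>H / 2\<close>, and the weighted \<open>L\<^sup>q\<close> term, \<open>q = 2n/(n-2)\<close>, is at most a
  constant times \<open>H\<close>.

  Both rest on an identity (\<open>ground_state\<close>). The function \<open>x\<^sub>n r powr (-n/2) f(s)\<close> is positive in the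
  half space, and radially the problem has become two-dimensional: dividing its negative Laplacian,
  less the Hardy potential, by the function itself leaves just \<open>- (f''/f)(s) / r\<^sup>2\<close>. Hence, with \<open>F\<close>
  the logarithmic gradient of that function,
  \<open>H = \<integral>|\<nabla>u - u F|\<^sup>2 + \<integral>(-f''/f)(s) u\<^sup>2/r\<^sup>2\<close>: every positive concave \<open>f\<close> on the half line
  yields a lower bound for \<open>H\<close> (\<open>hardy_energy_ge\<close>). Three choices are used. The function
  \<open>1 - exp (-s/2) / 2\<close> controls the remainder term with a factor two to spare; \<open>sqrt (1 + s)\<close>
  gives \<open>\<integral>X\<^sub>1\<^sup>2 u\<^sup>2/r\<^sup>2 \<le> 4 H\<close>; and a smoothed corner \<open>min (s, J)\<close> gives
  \<open>\<integral>u\<^sup>2/r\<^sup>2 \<le> C (1 + J) H\<close> over the shell \<open>|s - J| \<le> 2\<close>.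

  For the \<open>L\<^sup>q\<close> term the half ball is cut into the shells \<open>j \<le> s \<le> j + 1\<close>. Multiply \<open>u\<close> by a cutoff
  adapted to the \<open>j\<close>-th shell and apply the ordinary Sobolev inequality. The identity with \<open>f = 1\<close>
  turns the resulting Dirichlet integral into a quantity \<open>T\<^sub>j\<close>, the part in the \<open>j\<close>-th shell of
  \<open>\<integral>|\<nabla>u - u F|\<^sup>2 + u\<^sup>2/r\<^sup>2\<close>; applying it before estimating is what avoids the term
  \<open>|F|\<^sup>2 u\<^sup>2\<close>, which is singular at the flat boundary. The lower bounds above give
  \<open>T\<^sub>j \<le> C (1 + j) H\<close> and \<open>\<Sum>T\<^sub>j / (1 + j)\<^sup>2 \<le> C H\<close>. With \<open>p = q/2 = n/(n-2)\<close> the exponent of \<open>X\<^sub>1\<close> is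
  exactly \<open>1 + p\<close>, and
  \<open>\<Sum>(1 + j) powr (- 1 - p) T\<^sub>j powr p = \<Sum>(T\<^sub>j / (1 + j)\<^sup>2) (T\<^sub>j / (1 + j)) powr (p - 1) \<le> C H powr p\<close>,
  which is the claim (\<open>log_sobolev\<close>).

  The Sobolev inequality itself (\<open>sobolev_inequality\<close>) is obtained by truncation. Comparing \<open>u\<close> with
  its translates by vectors of a ball gives a Nash-type inequality (\<open>nash_ball\<close>). Applied to smooth
  truncations of \<open>u\<close> between two consecutive dyadic levels, with the radius chosen according to the
  measure of the superlevel set, it can be summed over all levels: the Dirichlet integrals of the
  truncations live on disjoint sets, so they add up to at most a constant times that of \<open>u\<close>.
\<close>

section \<open>Differentiable functions with compact support\<close>

text \<open>
  The gradient is carried along as \<open>g\<close>, and \<open>K\<close> is any compact set off which \<open>u\<close> vanishes rather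
  than the support itself, so that products and compositions keep the same \<open>K\<close>.
\<close>

definition C1_supp :: "'a::euclidean_space set \<Rightarrow> ('a \<Rightarrow> real) \<Rightarrow> ('a \<Rightarrow> 'a) \<Rightarrow> bool" where
  "C1_supp K u g \<longleftrightarrow> compact K \<and> (\<forall>x. GDERIV u x :> g x) \<and> continuous_on UNIV g \<and>
     (\<forall>x. x \<notin> K \<longrightarrow> u x = 0)"

lemma integrable_compact_support:
  fixes f :: "'a::euclidean_space \<Rightarrow> 'b::euclidean_space"
  assumes "compact K" "continuous_on K f" "\<And>x. x \<notin> K \<Longrightarrow> f x = 0"
  shows "integrable lborel f"
proof -
  have "f = (\<lambda>x. indicator K x *\<^sub>R f x)"
    using assms(3) by (auto simp: indicator_def fun_eq_iff)
  then show ?thesis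
    using borel_integrable_compact[OF assms(1,2)] by simp
qed

lemma C1_supp_has_derivative:
  "C1_supp K u g \<Longrightarrow> (u has_derivative (\<lambda>h. h \<bullet> g x)) (at x)"
  by (simp add: C1_supp_def gderiv_def)

lemma C1_supp_zero: "C1_supp K u g \<Longrightarrow> x \<notin> K \<Longrightarrow> u x = 0"
  by (simp add: C1_supp_def)

lemma C1_supp_cont: "C1_supp K u g \<Longrightarrow> continuous_on S u"
  by (meson C1_supp_has_derivative has_derivative_at_withinI has_derivative_continuous_on)

lemma C1_supp_cont_grad: "C1_supp K u g \<Longrightarrow> continuous_on S g"
  unfolding C1_supp_def using continuous_on_subset by blast

lemma C1_supp_compact: "C1_supp K u g \<Longrightarrow> compact K"
  by (simp add: C1_supp_def)

lemma C1_supp_grad_zero: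
  assumes "C1_supp K u g" "x \<notin> K"
  shows "g x = 0"
proof -
  have "open (- K)"
    using assms by (simp add: C1_supp_def compact_imp_closed open_Compl)
  moreover have "((\<lambda>x. 0::real) has_derivative (\<lambda>h. 0)) (at x)"
    by simp
  ultimately have "(u has_derivative (\<lambda>h. 0)) (at x)"
    using has_derivative_transform_within_open[of "\<lambda>x. 0::real" "\<lambda>h. 0" x UNIV "-K" u] assms
    by (auto simp: C1_supp_def)
  then have "(\<lambda>h. h \<bullet> g x) = (\<lambda>h. 0)"
    using C1_supp_has_derivative[OF assms(1)] has_derivative_unique by blast
  then have "g x \<bullet> g x = 0" by metis
  then show ?thesis by simp
qed

text \<open>
  The factor \<open>w\<close> may be singular away from \<open>K\<close>, as \<open>1 / (x \<bullet> e)\<close> and functions of \<open>ln |x|\<close> are: off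
  \<open>K\<close> the product is zero whatever value \<open>w\<close> takes, and \<open>U\<close> and the complement of \<open>K\<close> are an open cover.
\<close>

lemma C1_supp_mult:
  assumes u: "C1_supp K u g" and "open U" "K \<subseteq> U"
    and w: "\<And>x. x \<in> U \<Longrightarrow> GDERIV w x :> w' x" and cw: "continuous_on U w'"
  shows "C1_supp K (\<lambda>x. w x * u x) (\<lambda>x. w x *\<^sub>R g x + u x *\<^sub>R w' x)"
proof -
  have K: "compact K" "open (- K)"
    using u by (auto simp: C1_supp_def compact_imp_closed open_Compl)
  have "GDERIV (\<lambda>x. w x * u x) x :> w x *\<^sub>R g x + u x *\<^sub>R w' x" for x
  proof (cases "x \<in> U")
    case True
    have "(w has_derivative (\<lambda>h. h \<bullet> w' x)) (at x)"
      using w[OF True] by (simp add: gderiv_def)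
    from has_derivative_mult[OF this C1_supp_has_derivative[OF u]]
    show ?thesis
      by (simp add: gderiv_def inner_add_right algebra_simps)
  next
    case False
    then have "x \<in> - K" using assms by auto
    moreover have "((\<lambda>x. 0::real) has_derivative (\<lambda>h. 0)) (at x)"
      by simp
    ultimately have "((\<lambda>x. w x * u x) has_derivative (\<lambda>h. 0)) (at x)"
      using has_derivative_transform_within_open[of "\<lambda>x. 0::real" "\<lambda>h. 0" x UNIV "-K" "\<lambda>x. w x * u x"] u K
      by (auto simp: C1_supp_def)
    then show ?thesis
      using C1_supp_grad_zero[OF u] C1_supp_zero[OF u] \<open>x \<in> - K\<close> by (simp add: gderiv_def)
  qed
  moreover have "continuous_on UNIV (\<lambda>x. w x *\<^sub>R g x + u x *\<^sub>R w' x)"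
  proof -
    have "continuous_on U w"
      using w unfolding gderiv_def
      by (meson has_derivative_at_withinI has_derivative_continuous_on)
    then have "continuous_on U (\<lambda>x. w x *\<^sub>R g x + u x *\<^sub>R w' x)"
      by (intro continuous_intros cw C1_supp_cont[OF u] C1_supp_cont_grad[OF u])
    moreover have "continuous_on (- K) (\<lambda>x. w x *\<^sub>R g x + u x *\<^sub>R w' x)"
      by (rule continuous_on_eq[of _ "\<lambda>x. 0"])
        (auto simp: C1_supp_grad_zero[OF u] C1_supp_zero[OF u])
    ultimately have "continuous_on (U \<union> - K) (\<lambda>x. w x *\<^sub>R g x + u x *\<^sub>R w' x)"
      using K \<open>open U\<close> by (simp add: continuous_on_open_Un)
    moreover have "U \<union> - K = UNIV" using assms by auto
    ultimately show ?thesis by simp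
  qed
  ultimately show ?thesis
    using u by (auto simp: C1_supp_def)
qed

lemma C1_supp_compose:
  assumes u: "C1_supp K u g" and h: "\<And>t. (h has_real_derivative h' t) (at t)"
    and "continuous_on UNIV h'" "h 0 = 0"
  shows "C1_supp K (\<lambda>x. h (u x)) (\<lambda>x. h' (u x) *\<^sub>R g x)"
proof -
  have "GDERIV (\<lambda>x. h (u x)) x :> h' (u x) *\<^sub>R g x" for x
    using has_derivative_compose[OF C1_supp_has_derivative[OF u] h[unfolded has_field_derivative_def]]
    by (simp add: gderiv_def)
  moreover have "continuous_on UNIV (\<lambda>x. h' (u x) *\<^sub>R g x)"
    by (intro continuous_intros C1_supp_cont_grad[OF u] continuous_on_compose2[OF assms(3) C1_supp_cont[OF u]]) auto
  ultimately show ?thesis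
    using u \<open>h 0 = 0\<close> by (auto simp: C1_supp_def)
qed

lemma integrable_supp:
  fixes f :: "'a::euclidean_space \<Rightarrow> 'b::euclidean_space"
  assumes "C1_supp K u g" "continuous_on K f" "\<And>x. x \<notin> K \<Longrightarrow> f x = 0"
  shows "integrable lborel f"
  using assms by (intro integrable_compact_support[of K]) (auto simp: C1_supp_def)

lemma integral_translate:
  fixes f :: "'a::euclidean_space \<Rightarrow> real"
  assumes "f \<in> borel_measurable borel"
  shows "(\<integral>x. f (x + y) \<partial>lborel) = (\<integral>x. f x \<partial>lborel)"
proof -
  have "(\<integral>x. f x \<partial>lborel) = (\<integral>x. f x \<partial>distr lborel borel ((+) y))"
    by (simp add: lborel_distr_plus)
  also have "\<dots> = (\<integral>x. f (y + x) \<partial>lborel)"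
    using assms by (subst integral_distr) auto
  finally show ?thesis by (simp add: add.commute)
qed

lemma C1_supp_bounded_grad:
  assumes "C1_supp K u g"
  obtains M where "M > 0" "\<And>x. norm (g x) \<le> M"
proof -
  have "bounded (g ` K)"
    using assms by (meson C1_supp_compact C1_supp_cont_grad compact_continuous_image compact_imp_bounded)
  then obtain M where "M > 0" "\<forall>y\<in>g ` K. norm y \<le> M" using bounded_pos by blast
  then have "norm (g x) \<le> M" for x
    using C1_supp_grad_zero[OF assms] by (cases "x \<in> K") auto
  then show thesis using that \<open>M > 0\<close> by blast
qed

text \<open>
  Integration by parts in its barest form. The integral of \<open>u (x + h e)\<close> does not depend on \<open>h\<close>, so
  the integrals of the difference quotients vanish; they are dominated by a multiple of the
  indicator of a ball.
\<close>

lemma integral_deriv_zero: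
  assumes u: "C1_supp K u g"
  shows "(\<integral>x. g x \<bullet> e \<partial>lborel) = 0"
proof -
  obtain M where M: "M > 0" "\<And>x. norm (g x) \<le> M"
    using C1_supp_bounded_grad[OF u] by blast
  obtain B where B: "\<forall>x\<in>K. norm x \<le> B"
    using compact_imp_bounded[OF C1_supp_compact[OF u]] by (auto simp: bounded_iff)
  define h where "h m = 1 / (real m + 1)" for m
  define s where "s m x = (u (x + h m *\<^sub>R e) - u x) / h m" for m x
  have h: "h m > 0" "h m \<le> 1" for m by (auto simp: h_def)
  have hlim: "h \<longlonglongrightarrow> 0" unfolding h_def
    by (rule real_tendsto_divide_at_top) (auto intro!: filterlim_tendsto_add_at_top filterlim_real_sequentially simp: add.commute)
  have um: "u \<in> borel_measurable borel"
    by (rule borel_measurable_continuous_onI[OF C1_supp_cont[OF u]])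
  have ui: "integrable lborel u"
    by (rule integrable_supp[OF u]) (auto intro: C1_supp_cont[OF u] C1_supp_zero[OF u])
  have ui2: "integrable lborel (\<lambda>x. u (x + y))" for y
  proof (rule integrable_compact_support)
    show "compact ((\<lambda>z. - y + z) ` K)"
      by (rule compact_translation[OF C1_supp_compact[OF u]])
    show "continuous_on ((\<lambda>z. - y + z) ` K) (\<lambda>x. u (x + y))"
      by (intro continuous_on_compose2[OF C1_supp_cont[OF u, of UNIV]] continuous_intros) auto
    show "u (x + y) = 0" if "x \<notin> (\<lambda>z. - y + z) ` K" for x
      using that C1_supp_zero[OF u, of "x + y"] by (force simp: image_iff)
  qed
  have zero: "(\<integral>x. s m x \<partial>lborel) = 0" for m
    unfolding s_def using ui ui2 by (simp add: integral_translate[OF um])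
  have lip: "\<bar>u (x + y) - u x\<bar> \<le> M * norm y" for x y
  proof -
    have "norm (u (x + y) - u x) \<le> M * norm (x + y - x)"
    proof (rule differentiable_bound[of UNIV u "\<lambda>x h. h \<bullet> g x"])
      show "onorm (\<lambda>h. h \<bullet> g z) \<le> M" for z
        by (rule onorm_le) (metis M(2) Cauchy_Schwarz_ineq2 mult.commute mult_left_mono norm_ge_zero order_trans real_norm_def)
    qed (auto intro: C1_supp_has_derivative[OF u])
    then show ?thesis by simp
  qed
  have "(\<lambda>m. \<integral>x. s m x \<partial>lborel) \<longlonglongrightarrow> (\<integral>x. g x \<bullet> e \<partial>lborel)"
  proof (rule integral_dominated_convergence[where w="\<lambda>x. indicator (cball 0 (B + norm e)) x *\<^sub>R (M * norm e)"])
    show "(\<lambda>x. g x \<bullet> e) \<in> borel_measurable lborel"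
      using C1_supp_cont_grad[OF u, of UNIV] by (intro borel_measurable_inner) (auto intro: borel_measurable_continuous_onI)
    show "s m \<in> borel_measurable lborel" for m
      unfolding s_def using um by measurable
    show "integrable lborel (\<lambda>x::'a. indicator (cball 0 (B + norm e)) x *\<^sub>R (M * norm e))"
      by (rule borel_integrable_compact) auto
    show "AE x in lborel. (\<lambda>m. s m x) \<longlonglongrightarrow> g x \<bullet> e"
    proof (rule AE_I2)
      fix x
      have "((\<lambda>t. u (x + t *\<^sub>R e)) has_derivative (\<lambda>t. (t *\<^sub>R e) \<bullet> g x)) (at 0)"
        by (rule has_derivative_compose[of "\<lambda>t. x + t *\<^sub>R e" "\<lambda>t. t *\<^sub>R e" 0 UNIV u])
          (auto intro!: derivative_eq_intros C1_supp_has_derivative[OF u])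
      then have "((\<lambda>t. u (x + t *\<^sub>R e)) has_real_derivative (g x \<bullet> e)) (at 0)"
        by (simp add: has_field_derivative_def inner_commute mult_commute_abs)
      then have "((\<lambda>t. (u (x + t *\<^sub>R e) - u x) / t) \<longlongrightarrow> g x \<bullet> e) (at 0)"
        by (simp add: DERIV_def)
      moreover have "filterlim h (at 0) sequentially"
        using hlim h(1) by (simp add: filterlim_at less_imp_neq[symmetric])
      ultimately show "(\<lambda>m. s m x) \<longlonglongrightarrow> g x \<bullet> e"
        unfolding s_def by (rule filterlim_compose)
    qed
    show "AE x in lborel. norm (s m x) \<le> indicator (cball 0 (B + norm e)) x *\<^sub>R (M * norm e)" for m
    proof (rule AE_I2)
      fix x
      show "norm (s m x) \<le> indicator (cball 0 (B + norm e)) x *\<^sub>R (M * norm e)"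
      proof (cases "norm x \<le> B + norm e")
        case True
        have "\<bar>s m x\<bar> \<le> M * norm e"
          unfolding s_def using lip[of x "h m *\<^sub>R e"] h[of m] by (simp add: pos_divide_le_eq mult_ac)
        then show ?thesis using True by simp
      next
        case False
        have "norm (h m *\<^sub>R e) \<le> norm e" using h[of m] by (simp add: mult_left_le_one_le)
        then have "norm (x + h m *\<^sub>R e) > B"
          using False norm_triangle_ineq2[of x "- (h m *\<^sub>R e)"] by simp
        moreover have "norm x > B" using False norm_ge_zero[of e] by linarith
        ultimately have "u x = 0" "u (x + h m *\<^sub>R e) = 0"
          using B C1_supp_zero[OF u] by force+
        then show ?thesis using False by (simp add: s_def)
      qed
    qed
  qed
  then have "(\<lambda>m. 0::real) \<longlonglongrightarrow> (\<integral>x. g x \<bullet> e \<partial>lborel)"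
    by (simp add: zero)
  then show ?thesis
    by (simp add: LIMSEQ_const_iff)
qed

text \<open>
  The integrand is the divergence of the vector field \<open>u(x) x\<close>.
\<close>

lemma integral_radial_zero:
  fixes u :: "'a::euclidean_space \<Rightarrow> real"
  assumes u: "C1_supp K u g"
  shows "(\<integral>x. real DIM('a) * u x + x \<bullet> g x \<partial>lborel) = 0"
proof -
  have *: "C1_supp K (\<lambda>x. (x \<bullet> b) * u x) (\<lambda>x. (x \<bullet> b) *\<^sub>R g x + u x *\<^sub>R b)" for b
    by (rule C1_supp_mult[OF u open_UNIV]) (auto simp: gderiv_def intro!: derivative_eq_intros)
  have i: "integrable lborel (\<lambda>x. ((x \<bullet> b) *\<^sub>R g x + u x *\<^sub>R b) \<bullet> b)" for b
    by (rule integrable_supp[OF u])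
      (auto intro!: continuous_intros C1_supp_cont[OF u] C1_supp_cont_grad[OF u]
        simp: C1_supp_grad_zero[OF u] C1_supp_zero[OF u])
  have "real DIM('a) * u x + x \<bullet> g x = (\<Sum>b\<in>Basis. ((x \<bullet> b) *\<^sub>R g x + u x *\<^sub>R b) \<bullet> b)" for x
    by (simp add: inner_add_left sum.distrib euclidean_inner[of x "g x"] algebra_simps)
  then have "(\<integral>x. real DIM('a) * u x + x \<bullet> g x \<partial>lborel)
     = (\<Sum>b\<in>Basis. \<integral>x. ((x \<bullet> b) *\<^sub>R g x + u x *\<^sub>R b) \<bullet> b \<partial>lborel)"
    using i by simp
  also have "\<dots> = 0"
    using integral_deriv_zero[OF *] by simp
  finally show ?thesis .
qed

lemma integrable_deriv: "C1_supp K u g \<Longrightarrow> integrable lborel (\<lambda>x. g x \<bullet> e)"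
  by (rule integrable_supp)
    (auto intro!: continuous_intros C1_supp_cont_grad simp: C1_supp_grad_zero)

lemma integrable_radial:
  assumes "C1_supp K u g"
  shows "integrable lborel (\<lambda>x. c * u x + x \<bullet> g x)"
  by (rule integrable_supp[OF assms])
    (auto intro!: continuous_intros C1_supp_cont[OF assms] C1_supp_cont_grad[OF assms]
      simp: C1_supp_grad_zero[OF assms] C1_supp_zero[OF assms])

section \<open>The ground state substitution in a half ball\<close>

text \<open>
  The logarithmic gradient of the ground state \<open>(x \<bullet> e) r powr (-n/2) f(ln (R / r))\<close>, where
  \<open>b = f'/f\<close>.
\<close>

definition hardy_field :: "'a::euclidean_space \<Rightarrow> real \<Rightarrow> (real \<Rightarrow> real) \<Rightarrow> 'a \<Rightarrow> 'a" where
  "hardy_field e R b x =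
     (1 / (x \<bullet> e)) *\<^sub>R e - ((real DIM('a) / 2 + b (ln (R / norm x))) / (norm x)\<^sup>2) *\<^sub>R x"

lemma open_half_ball: "open {x::'a::euclidean_space. x \<bullet> e > 0 \<and> norm x < R}"
proof -
  have "{x::'a. x \<bullet> e > 0 \<and> norm x < R} = {x. 0 < x \<bullet> e} \<inter> {x. norm x < R}" by auto
  then show ?thesis
    by (simp add: open_Int open_Collect_less continuous_intros)
qed

lemma GDERIV_fun_norm:
  assumes "x \<noteq> 0" "(H has_real_derivative H') (at (norm x))"
  shows "GDERIV (\<lambda>x. H (norm x)) x :> (H' / norm x) *\<^sub>R x"
  using GDERIV_DERIV_compose[OF GDERIV_norm[OF assms(1)] assms(2)]
  by (simp add: sgn_div_norm field_simps)

lemma GDERIV_inverse_inner: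
  assumes "x \<bullet> e \<noteq> 0"
  shows "GDERIV (\<lambda>x. 1 / (x \<bullet> e)) x :> (- 1 / (x \<bullet> e)\<^sup>2) *\<^sub>R e"
proof -
  have "GDERIV (\<lambda>x. x \<bullet> e) x :> e"
    by (simp add: gderiv_def has_derivative_inner_left)
  from GDERIV_inverse[OF this assms] show ?thesis
    by (simp add: field_simps power2_eq_square)
qed

text \<open>
  The algebra behind the ground state identity. With \<open>F\<close> the Hardy field,
  \<open>|g - u F|\<^sup>2 = |g|\<^sup>2 - div (u\<^sup>2 F) + u\<^sup>2 (div F + |F|\<^sup>2)\<close> and
  \<open>div F + |F|\<^sup>2 = (b\<^sup>2 + b' - N\<^sup>2/4) / r\<^sup>2\<close>. The divergence is written as two brackets, one for the part of
  \<open>F\<close> along \<open>e\<close> and one for the radial part, each of which integrates to zero.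
\<close>

lemma hardy_pointwise:
  fixes x e g :: "'a::euclidean_space" and u b b' N :: real
  assumes "x \<bullet> e > 0" "norm e = 1"
  defines "r2 \<equiv> (norm x)\<^sup>2"
  shows "(norm (g - u *\<^sub>R ((1 / (x \<bullet> e)) *\<^sub>R e - ((N / 2 + b) / r2) *\<^sub>R x)))\<^sup>2
    = (norm g)\<^sup>2
      - ((1 / (x \<bullet> e)) *\<^sub>R (u *\<^sub>R g + u *\<^sub>R g) + (u * u) *\<^sub>R ((- 1 / (x \<bullet> e)\<^sup>2) *\<^sub>R e)) \<bullet> e
      + (N * ((N / 2 + b) / r2 * (u * u))
         + x \<bullet> (((N / 2 + b) / r2) *\<^sub>R (u *\<^sub>R g + u *\<^sub>R g)
              + (u * u) *\<^sub>R ((- (b' + 2 * (N / 2 + b)) / r2\<^sup>2) *\<^sub>R x)))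
      + (b\<^sup>2 + b') * (u\<^sup>2 / r2) - N\<^sup>2 / 4 * (u\<^sup>2 / r2)"
proof -
  have "x \<noteq> 0" using assms by auto
  then have r2: "x \<bullet> x = r2" "r2 > 0" by (auto simp: r2_def power2_norm_eq_inner)
  have e: "e \<bullet> e = 1" using assms by (simp add: norm_eq_sqrt_inner)
  define a where "a = x \<bullet> e"
  define c where "c = (N/2 + b) / r2"
  have cc: "c * r2 = N/2 + b" using r2 by (simp add: c_def)
  have a: "a > 0" "e \<bullet> x = a" using assms by (auto simp: a_def inner_commute)
  have L: "(norm (g - u *\<^sub>R ((1 / a) *\<^sub>R e - c *\<^sub>R x)))\<^sup>2
     = g \<bullet> g - 2 * u * ((g \<bullet> e) / a - c * (g \<bullet> x)) + u\<^sup>2 * (1 / a\<^sup>2 - 2 * c + c\<^sup>2 * r2)"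
  proof -
    have "(norm (g - u *\<^sub>R (p *\<^sub>R e - c *\<^sub>R x)))\<^sup>2
      = g \<bullet> g - 2 * u * (p * (g \<bullet> e) - c * (g \<bullet> x))
        + u\<^sup>2 * (p\<^sup>2 * (e \<bullet> e) - 2 * p * c * (e \<bullet> x) + c\<^sup>2 * (x \<bullet> x))" for p
      unfolding power2_norm_eq_inner inner_diff_left inner_diff_right inner_scaleR_left inner_scaleR_right
        inner_commute[of e g] inner_commute[of x g] inner_commute[of x e]
      by (simp add: power2_eq_square algebra_simps)
    from this[of "1/a"] show ?thesis
      using a r2 e by (simp add: power_divide)
  qed
  have k1: "u\<^sup>2 * (1 / a\<^sup>2 - 2 * c + c\<^sup>2 * r2) = u\<^sup>2 / a\<^sup>2 + N * c * u\<^sup>2 - u\<^sup>2 * ((b' + 2 * (c * r2)) / r2)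
      + (b\<^sup>2 + b') * (u\<^sup>2 / r2) - N\<^sup>2 / 4 * (u\<^sup>2 / r2)"
  proof -
    have b: "b = c * r2 - N/2" using cc by simp
    show ?thesis unfolding b using r2(2) a(1) by (simp add: field_simps power2_eq_square)
  qed
  have k2: "((1 / a) *\<^sub>R (u *\<^sub>R g + u *\<^sub>R g) + (u * u) *\<^sub>R ((- 1 / a\<^sup>2) *\<^sub>R e)) \<bullet> e
      = 2 * u * ((g \<bullet> e) / a) - u\<^sup>2 / a\<^sup>2"
    using e by (simp add: inner_add_left inner_diff_left power2_eq_square add_divide_distrib[symmetric])
  have k3: "x \<bullet> (c *\<^sub>R (u *\<^sub>R g + u *\<^sub>R g) + (u * u) *\<^sub>R ((- (b' + 2 * (c * r2)) / r2\<^sup>2) *\<^sub>R x))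
      = 2 * u * (c * (g \<bullet> x)) - u\<^sup>2 * ((b' + 2 * (c * r2)) / r2)"
    using r2 by (simp add: inner_add_right inner_commute[of x g] power2_eq_square field_simps)
  show ?thesis
    unfolding a_def[symmetric] c_def[symmetric]
    unfolding cc[symmetric]
    unfolding L k1 k2 k3 power2_norm_eq_inner[of g]
    by (simp add: right_diff_distrib power2_eq_square)
qed

text \<open>
  The upper half space is \<open>x \<bullet> e > 0\<close> for a unit vector \<open>e\<close>.
\<close>

locale half_ball_fun =
  fixes K :: "'a::euclidean_space set" and e :: 'a and R :: real and u :: "'a \<Rightarrow> real" and g :: "'a \<Rightarrow> 'a"
  assumes u: "C1_supp K u g" and e: "norm e = 1" and R: "R > 0"
    and K: "K \<subseteq> {x. x \<bullet> e > 0 \<and> norm x < R}"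
begin

definition "lr x = ln (R / norm x)"

lemma K_nz: "x \<in> K \<Longrightarrow> norm x > 0" "x \<in> K \<Longrightarrow> x \<bullet> e > 0" "x \<in> K \<Longrightarrow> norm x < R"
  using K by auto

lemma lr_pos: "x \<in> K \<Longrightarrow> lr x > 0"
  using K_nz[of x] by (auto simp: lr_def intro!: ln_gt_zero)

lemma cont_lr: "continuous_on K lr"
  unfolding lr_def using K_nz R by (intro continuous_intros) fastforce+

lemma cont_fun_lr: "continuous_on {0<..} b \<Longrightarrow> continuous_on K (\<lambda>x. b (lr x))"
  by (rule continuous_on_compose2[OF _ cont_lr]) (auto dest: lr_pos)

lemma integrable_weight:
  assumes "continuous_on K w"
  shows "integrable lborel (\<lambda>x. w x * ((u x)\<^sup>2 / (norm x)\<^sup>2))"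
  by (rule integrable_supp[OF u])
    (use assms K_nz C1_supp_zero[OF u] in \<open>fastforce intro!: continuous_intros C1_supp_cont[OF u]\<close>)+

lemma integrable_grad: "integrable lborel (\<lambda>x. (norm (g x))\<^sup>2)"
  by (rule integrable_supp[OF u])
    (auto intro!: continuous_intros C1_supp_cont_grad[OF u] simp: C1_supp_grad_zero[OF u])

lemma cont_hardy_field:
  assumes "continuous_on {0<..} b"
  shows "continuous_on K (hardy_field e R b)"
  unfolding hardy_field_def lr_def[symmetric]
  using K_nz by (intro continuous_intros cont_fun_lr assms) fastforce+

lemma integrable_hardy:
  assumes "continuous_on {0<..} b"
  shows "integrable lborel (\<lambda>x. (norm (g x - u x *\<^sub>R hardy_field e R b x))\<^sup>2)"
  by (rule integrable_supp[OF u])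
    (auto intro!: continuous_intros C1_supp_cont_grad[OF u] C1_supp_cont[OF u] cont_hardy_field[OF assms]
     simp: C1_supp_grad_zero[OF u] C1_supp_zero[OF u])

text \<open>
  The Hardy deficit: what the Hardy inequality with the constant \<open>n\<^sup>2/4\<close> leaves of the Dirichlet integral.
\<close>

definition "hardy_energy = (\<integral>x. (norm (g x))\<^sup>2 \<partial>lborel) - (real DIM('a))\<^sup>2 / 4 * (\<integral>x. (u x)\<^sup>2 / (norm x)\<^sup>2 \<partial>lborel)"

text \<open>
  The logarithmic derivative \<open>b\<close> may be prescribed directly; for \<open>b = f'/f\<close> one has
  \<open>b\<^sup>2 + b' = f''/f\<close>.
\<close>

lemma ground_state:
  assumes b: "\<And>s. s > 0 \<Longrightarrow> (b has_real_derivative b' s) (at s)"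
    and b': "continuous_on {0<..} b'"
  shows "hardy_energy =
    (\<integral>x. (norm (g x - u x *\<^sub>R hardy_field e R b x))\<^sup>2 \<partial>lborel)
    - (\<integral>x. ((b (lr x))\<^sup>2 + b' (lr x)) * ((u x)\<^sup>2 / (norm x)\<^sup>2) \<partial>lborel)"
proof -
  define U where "U = {x. x \<bullet> e > 0 \<and> norm x < R}"
  have U: "open U" "K \<subseteq> U" using K by (auto simp: U_def open_half_ball)
  have U0: "x \<in> U \<Longrightarrow> x \<noteq> 0 \<and> x \<bullet> e > 0 \<and> ln (R / norm x) > 0" for x
    by (auto simp: U_def intro!: ln_gt_zero) (subst less_divide_eq_1_pos; fastforce)
  have contb: "continuous_on {0<..} b"
    by (meson b DERIV_isCont continuous_at_imp_continuous_on greaterThan_iff)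
  have cU: "continuous_on U (\<lambda>x. f (ln (R / norm x)))" if "continuous_on {0<..} f" for f :: "real \<Rightarrow> real"
    by (rule continuous_on_compose2[OF that]) (use U0 R in \<open>force intro!: continuous_intros\<close>)+
  define h where "h x = (real DIM('a) / 2 + b (ln (R / norm x))) / (norm x)\<^sup>2" for x :: 'a
  define h' where "h' x = (- (b' (ln (R / norm x)) + 2 * (real DIM('a) / 2 + b (ln (R / norm x)))) / ((norm x)\<^sup>2)\<^sup>2) *\<^sub>R x" for x :: 'a
  have uu: "C1_supp K (\<lambda>x. u x * u x) (\<lambda>x. u x *\<^sub>R g x + u x *\<^sub>R g x)"
    by (rule C1_supp_mult[OF u open_UNIV]) (use u in \<open>auto simp: C1_supp_def\<close>)
  have w1: "C1_supp K (\<lambda>x. 1 / (x \<bullet> e) * (u x * u x))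
     (\<lambda>x. (1 / (x \<bullet> e)) *\<^sub>R (u x *\<^sub>R g x + u x *\<^sub>R g x) + (u x * u x) *\<^sub>R ((- 1 / (x \<bullet> e)\<^sup>2) *\<^sub>R e))"
    by (rule C1_supp_mult[OF uu U])
      (use U0 in \<open>fastforce intro!: GDERIV_inverse_inner continuous_intros\<close>)+
  have dh: "GDERIV h x :> h' x" if "x \<in> U" for x
  proof -
    have x: "norm x > 0" "ln (R / norm x) > 0" using U0[OF that] by auto
    have bb: "((\<lambda>r. b (ln (R / r))) has_real_derivative b' (ln (R / norm x)) * (- 1 / norm x)) (at (norm x))"
      by (rule DERIV_chain2[where g="\<lambda>r. ln (R / r)", OF b[OF x(2)]]) (use x R in \<open>auto intro!: derivative_eq_intros simp: field_simps power2_eq_square\<close>)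
    have "((\<lambda>r. (real DIM('a) / 2 + b (ln (R / r))) / r\<^sup>2) has_real_derivative
        - (b' (ln (R / norm x)) + 2 * (real DIM('a) / 2 + b (ln (R / norm x)))) / (norm x)^3) (at (norm x))"
      by (rule derivative_eq_intros bb refl | use x in \<open>simp add: field_simps power2_eq_square power3_eq_cube\<close>)+
    from GDERIV_fun_norm[OF _ this] x
    show ?thesis by (simp add: h_def[abs_def] h'_def power2_eq_square power3_eq_cube mult_ac)
  qed
  have ch: "continuous_on U h'"
    unfolding h'_def by (intro continuous_intros cU b' contb) (use U0 in auto)
  have w2: "C1_supp K (\<lambda>x. h x * (u x * u x))
     (\<lambda>x. h x *\<^sub>R (u x *\<^sub>R g x + u x *\<^sub>R g x) + (u x * u x) *\<^sub>R h' x)"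
    by (rule C1_supp_mult[OF uu U dh ch])
  define D1 where "D1 x = ((1 / (x \<bullet> e)) *\<^sub>R (u x *\<^sub>R g x + u x *\<^sub>R g x) + (u x * u x) *\<^sub>R ((- 1 / (x \<bullet> e)\<^sup>2) *\<^sub>R e)) \<bullet> e" for x
  define D2 where "D2 x = real DIM('a) * (h x * (u x * u x)) + x \<bullet> (h x *\<^sub>R (u x *\<^sub>R g x + u x *\<^sub>R g x) + (u x * u x) *\<^sub>R h' x)" for x
  have D: "(\<integral>x. D1 x \<partial>lborel) = 0" "(\<integral>x. D2 x \<partial>lborel) = 0"
    unfolding D1_def D2_def by (rule integral_deriv_zero[OF w1], rule integral_radial_zero[OF w2])
  have Di: "integrable lborel D1" "integrable lborel D2"
    unfolding D1_def D2_def by (rule integrable_deriv[OF w1], rule integrable_radial[OF w2])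
  have pw: "(norm (g x - u x *\<^sub>R hardy_field e R b x))\<^sup>2 = (norm (g x))\<^sup>2 - D1 x + D2 x
     + ((b (lr x))\<^sup>2 + b' (lr x)) * ((u x)\<^sup>2 / (norm x)\<^sup>2) - (real DIM('a))\<^sup>2 / 4 * ((u x)\<^sup>2 / (norm x)\<^sup>2)" for x
  proof (cases "x \<in> K")
    case True
    show ?thesis
      unfolding D1_def D2_def h_def h'_def hardy_field_def lr_def
      using hardy_pointwise[of x e "g x" "u x" "real DIM('a)" _ "b' (ln (R / norm x))"] K_nz[OF True] e by simp
  next
    case False
    then show ?thesis
      by (simp add: D1_def D2_def C1_supp_grad_zero[OF u] C1_supp_zero[OF u])
  qed
  have i1: "integrable lborel (\<lambda>x. ((b (lr x))\<^sup>2 + b' (lr x)) * ((u x)\<^sup>2 / (norm x)\<^sup>2))"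
    by (intro integrable_weight continuous_intros cont_fun_lr b' contb)
  have i2: "integrable lborel (\<lambda>x. (u x)\<^sup>2 / (norm x)\<^sup>2)"
    using integrable_weight[of "\<lambda>_. 1"] by simp
  have "(\<integral>x. (norm (g x - u x *\<^sub>R hardy_field e R b x))\<^sup>2 \<partial>lborel) =
    (\<integral>x. (norm (g x))\<^sup>2 \<partial>lborel) + (\<integral>x. ((b (lr x))\<^sup>2 + b' (lr x)) * ((u x)\<^sup>2 / (norm x)\<^sup>2) \<partial>lborel)
      - (real DIM('a))\<^sup>2 / 4 * (\<integral>x. (u x)\<^sup>2 / (norm x)\<^sup>2 \<partial>lborel)"
    unfolding pw using i1 i2 Di integrable_grad D
    by (simp del: times_divide_eq_left times_divide_eq_right)
  then show ?thesis by (simp add: hardy_energy_def)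
qed

lemma hardy_energy_ground: "hardy_energy = (\<integral>x. (norm (g x - u x *\<^sub>R hardy_field e R (\<lambda>_. 0) x))\<^sup>2 \<partial>lborel)"
  using ground_state[of "\<lambda>_. 0" "\<lambda>_. 0"] by simp

text \<open>
  The potentials that the Hardy deficit dominates are those with a positive supersolution: it is
  enough that \<open>f'' + V f \<le> 0\<close> on the half line. Measurability of \<open>V\<close> is the right generality here,
  since one application has the indicator of an interval.
\<close>

lemma hardy_energy_ge:
  assumes f: "\<And>s. s > 0 \<Longrightarrow> f s > 0" "\<And>s. s > 0 \<Longrightarrow> (f has_real_derivative f' s) (at s)"
      "\<And>s. s > 0 \<Longrightarrow> (f' has_real_derivative f'' s) (at s)" "continuous_on {0<..} f''"
    and V: "\<And>s. s > 0 \<Longrightarrow> V s * f s \<le> - f'' s" and mV: "V \<in> borel_measurable borel" "\<And>s. V s \<ge> 0"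
  shows "(\<integral>x. V (lr x) * ((u x)\<^sup>2 / (norm x)\<^sup>2) \<partial>lborel) \<le> hardy_energy"
    "integrable lborel (\<lambda>x. V (lr x) * ((u x)\<^sup>2 / (norm x)\<^sup>2))"
proof -
  have c: "continuous_on {0<..} f" "continuous_on {0<..} f'"
    by (meson f DERIV_isCont continuous_at_imp_continuous_on greaterThan_iff)+
  have cq: "continuous_on {0<..} (\<lambda>s. f'' s / f s - (f' s / f s)\<^sup>2)" "continuous_on {0<..} (\<lambda>s. - f'' s / f s)"
    using f(1) by (force intro!: continuous_intros c f(4))+
  have "((\<lambda>s. f' s / f s) has_real_derivative (f'' s / f s - (f' s / f s)\<^sup>2)) (at s)" if "s > 0" for s
    using f(1)[OF that]
    by (auto intro!: derivative_eq_intros f that simp: field_simps power2_eq_square)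
  from ground_state[OF this cq(1)]
  have "hardy_energy = (\<integral>x. (norm (g x - u x *\<^sub>R hardy_field e R (\<lambda>s. f' s / f s) x))\<^sup>2 \<partial>lborel)
    - (\<integral>x. (f'' (lr x) / f (lr x)) * ((u x)\<^sup>2 / (norm x)\<^sup>2) \<partial>lborel)"
    by simp
  also have "\<dots> \<ge> - (\<integral>x. (f'' (lr x) / f (lr x)) * ((u x)\<^sup>2 / (norm x)\<^sup>2) \<partial>lborel)"
    by simp
  finally have 1: "(\<integral>x. (- f'' (lr x) / f (lr x)) * ((u x)\<^sup>2 / (norm x)\<^sup>2) \<partial>lborel) \<le> hardy_energy"
    by simp
  have i: "integrable lborel (\<lambda>x. (- f'' (lr x) / f (lr x)) * ((u x)\<^sup>2 / (norm x)\<^sup>2))"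
    by (rule integrable_weight) (rule cont_fun_lr[OF cq(2)])
  have le: "V (lr x) * ((u x)\<^sup>2 / (norm x)\<^sup>2) \<le> (- f'' (lr x) / f (lr x)) * ((u x)\<^sup>2 / (norm x)\<^sup>2)" for x
  proof (cases "x \<in> K")
    case True
    then show ?thesis
      using V[OF lr_pos[OF True]] f(1)[OF lr_pos[OF True]]
      by (intro mult_right_mono) (auto simp: pos_le_minus_divide_eq)
  qed (simp add: C1_supp_zero[OF u])
  have um: "u \<in> borel_measurable borel"
    by (rule borel_measurable_continuous_onI[OF C1_supp_cont[OF u]])
  show i2: "integrable lborel (\<lambda>x. V (lr x) * ((u x)\<^sup>2 / (norm x)\<^sup>2))"
  proof (rule Bochner_Integration.integrable_bound[OF i])
    have lm: "lr \<in> borel_measurable borel" unfolding lr_def by measurable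
    show "(\<lambda>x. V (lr x) * ((u x)\<^sup>2 / (norm x)\<^sup>2)) \<in> borel_measurable lborel"
      using measurable_compose[OF lm mV(1)] um by measurable
    show "AE x in lborel. norm (V (lr x) * ((u x)\<^sup>2 / (norm x)\<^sup>2)) \<le> norm (- f'' (lr x) / f (lr x) * ((u x)\<^sup>2 / (norm x)\<^sup>2))"
      using le mV(2) by (intro AE_I2) (smt (verit) divide_nonneg_nonneg mult_nonneg_nonneg real_norm_def zero_le_power2)
  qed
  show "(\<integral>x. V (lr x) * ((u x)\<^sup>2 / (norm x)\<^sup>2) \<partial>lborel) \<le> hardy_energy"
    using integral_mono[OF i2 i le] 1 by simp
qed

end

section \<open>A Nash-type inequality\<close>

text \<open>
  This is the Cauchy-Schwarz inequality on the unit interval, proved as the nonnegativity of the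
  variance of \<open>f'\<close>.
\<close>

lemma square_increment_le:
  fixes f f' :: "real \<Rightarrow> real"
  assumes f: "\<And>t. (f has_real_derivative f' t) (at t)" and c: "continuous_on UNIV f'"
  shows "ennreal ((f 1 - f 0)\<^sup>2) \<le> (\<integral>\<^sup>+t. indicator {0..1} t * ennreal ((f' t)\<^sup>2) \<partial>lborel)"
proof -
  define m where "m = f 1 - f 0"
  have c1: "continuous_on {0..1} f'" using c continuous_on_subset by blast
  have 1: "(f' has_integral m) {0..1}"
    unfolding m_def
    by (rule fundamental_theorem_of_calculus)
      (auto simp: has_real_derivative_iff_has_vector_derivative[symmetric] intro!: DERIV_subset[OF f])
  have "(\<lambda>t. (f' t)\<^sup>2) integrable_on {0..1}"
    by (intro integrable_continuous_real continuous_intros c1)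
  then obtain I where I: "((\<lambda>t. (f' t)\<^sup>2) has_integral I) {0..1}" by blast
  have "((\<lambda>t. (f' t)\<^sup>2 - 2 * m * f' t + m\<^sup>2) has_integral (I - 2 * m * m + m\<^sup>2)) {0..1}"
    using has_integral_add[OF has_integral_diff[OF I has_integral_mult_right[OF 1, of "2*m"]]
      has_integral_const_real[of "m\<^sup>2" 0 1]] by simp
  then have "((\<lambda>t. (f' t - m)\<^sup>2) has_integral (I - m\<^sup>2)) {0..1}"
    by (simp add: power2_diff power2_eq_square algebra_simps)
  then have "0 \<le> I - m\<^sup>2" by (rule has_integral_nonneg) auto
  moreover have "(\<integral>\<^sup>+t. indicator {0..1} t * ennreal ((f' t)\<^sup>2) \<partial>lborel) = ennreal I"
    using nn_integral_has_integral_lebesgue[OF _ I]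
    by (simp add: ennreal_mult' ennreal_indicator nn_integral_completion)
  ultimately show ?thesis by (simp add: m_def ennreal_leI)
qed

lemma nn_integral_translate:
  fixes f :: "'a::euclidean_space \<Rightarrow> ennreal"
  assumes "f \<in> borel_measurable borel"
  shows "(\<integral>\<^sup>+x. f (x + y) \<partial>lborel) = (\<integral>\<^sup>+x. f x \<partial>lborel)"
proof -
  have "(\<integral>\<^sup>+x. f x \<partial>lborel) = (\<integral>\<^sup>+x. f x \<partial>distr lborel borel ((+) y))"
    by (simp add: lborel_distr_plus)
  also have "\<dots> = (\<integral>\<^sup>+x. f (y + x) \<partial>lborel)"
    using assms by (subst nn_integral_distr) auto
  finally show ?thesis by (simp add: add.commute)
qed

lemma C1_supp_measurable:
  assumes "C1_supp K u g"
  shows "u \<in> borel_measurable borel" "g \<in> borel_measurable borel"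
  using assms by (auto intro!: borel_measurable_continuous_onI C1_supp_cont C1_supp_cont_grad)

lemma C1_supp_integrables:
  assumes u: "C1_supp K u g"
  shows "integrable lborel (\<lambda>x. (norm (g x))\<^sup>2)" "integrable lborel (\<lambda>x. (u x)\<^sup>2)"
    "integrable lborel (\<lambda>x. \<bar>u x\<bar>)"
  by (rule integrable_supp[OF u];
      force intro!: continuous_intros C1_supp_cont[OF u] C1_supp_cont_grad[OF u]
      simp: C1_supp_grad_zero[OF u] C1_supp_zero[OF u])+

lemma translation_difference_L2:
  assumes u: "C1_supp K u g"
  shows "(\<integral>\<^sup>+x. ennreal ((u (x + y) - u x)\<^sup>2) \<partial>lborel)
    \<le> ennreal ((norm y)\<^sup>2 * (\<integral>x. (norm (g x))\<^sup>2 \<partial>lborel))"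
proof -
  note [measurable] = C1_supp_measurable[OF u]
  have "ennreal ((u (x + y) - u x)\<^sup>2)
      \<le> (\<integral>\<^sup>+t. indicator {0..1} t * ennreal ((norm y)\<^sup>2 * (norm (g (x + t *\<^sub>R y)))\<^sup>2) \<partial>lborel)" for x
  proof -
    have d: "((\<lambda>t. u (x + t *\<^sub>R y)) has_real_derivative (y \<bullet> g (x + t *\<^sub>R y))) (at t)" for t
    proof -
      have "((\<lambda>t. u (x + t *\<^sub>R y)) has_derivative (\<lambda>h. (h *\<^sub>R y) \<bullet> g (x + t *\<^sub>R y))) (at t)"
        by (rule has_derivative_compose[of "\<lambda>t. x + t *\<^sub>R y" "\<lambda>h. h *\<^sub>R y" t UNIV u])
          (auto intro!: derivative_eq_intros C1_supp_has_derivative[OF u])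
      then show ?thesis by (simp add: has_field_derivative_def mult_commute_abs)
    qed
    have c: "continuous_on UNIV (\<lambda>t. y \<bullet> g (x + t *\<^sub>R y))"
      by (intro continuous_intros continuous_on_compose2[OF C1_supp_cont_grad[OF u, of UNIV]]) auto
    have "ennreal ((u (x + y) - u x)\<^sup>2) \<le> (\<integral>\<^sup>+t. indicator {0..1} t * ennreal ((y \<bullet> g (x + t *\<^sub>R y))\<^sup>2) \<partial>lborel)"
      using square_increment_le[OF d c] by simp
    also have "\<dots> \<le> (\<integral>\<^sup>+t. indicator {0..1} t * ennreal ((norm y)\<^sup>2 * (norm (g (x + t *\<^sub>R y)))\<^sup>2) \<partial>lborel)"
      by (intro nn_integral_mono mult_left_mono ennreal_leI)
        (simp_all add: Cauchy_Schwarz_ineq power2_norm_eq_inner)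
    finally show ?thesis .
  qed
  then have "(\<integral>\<^sup>+x. ennreal ((u (x + y) - u x)\<^sup>2) \<partial>lborel)
    \<le> (\<integral>\<^sup>+x. \<integral>\<^sup>+t. indicator {0..1::real} t * ennreal ((norm y)\<^sup>2 * (norm (g (x + t *\<^sub>R y)))\<^sup>2) \<partial>lborel \<partial>lborel)"
    by (intro nn_integral_mono) auto
  also have "\<dots> = (\<integral>\<^sup>+t. \<integral>\<^sup>+x. indicator {0..1::real} t * ennreal ((norm y)\<^sup>2 * (norm (g (x + t *\<^sub>R y)))\<^sup>2) \<partial>lborel \<partial>lborel)"
    by (rule lborel_pair.Fubini'[symmetric]) measurable
  also have "\<dots> = (\<integral>\<^sup>+t. indicator {0..1::real} t * ennreal ((norm y)\<^sup>2 * (\<integral>x. (norm (g x))\<^sup>2 \<partial>lborel)) \<partial>lborel)"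
  proof (rule nn_integral_cong)
    fix t :: real
    have "(\<integral>\<^sup>+x. indicator {0..1::real} t * ennreal ((norm y)\<^sup>2 * (norm (g (x + t *\<^sub>R y)))\<^sup>2) \<partial>lborel)
      = indicator {0..1::real} t * (\<integral>\<^sup>+x. ennreal ((norm y)\<^sup>2 * (norm (g (x + t *\<^sub>R y)))\<^sup>2) \<partial>lborel)"
      by (rule nn_integral_cmult) measurable
    also have "(\<integral>\<^sup>+x. ennreal ((norm y)\<^sup>2 * (norm (g (x + t *\<^sub>R y)))\<^sup>2) \<partial>lborel)
      = (\<integral>\<^sup>+x. ennreal ((norm y)\<^sup>2 * (norm (g x))\<^sup>2) \<partial>lborel)"
      by (rule nn_integral_translate[of "\<lambda>x. ennreal ((norm y)\<^sup>2 * (norm (g x))\<^sup>2)"]) measurable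
    also have "\<dots> = ennreal ((norm y)\<^sup>2 * (\<integral>x. (norm (g x))\<^sup>2 \<partial>lborel))"
      using C1_supp_integrables(1)[OF u] by (subst nn_integral_eq_integral) auto
    finally show "(\<integral>\<^sup>+x. indicator {0..1::real} t * ennreal ((norm y)\<^sup>2 * (norm (g (x + t *\<^sub>R y)))\<^sup>2) \<partial>lborel)
      = indicator {0..1::real} t * ennreal ((norm y)\<^sup>2 * (\<integral>x. (norm (g x))\<^sup>2 \<partial>lborel))" .
  qed
  also have "\<dots> = ennreal ((norm y)\<^sup>2 * (\<integral>x. (norm (g x))\<^sup>2 \<partial>lborel))"
    by (subst nn_integral_multc) auto
  finally show ?thesis .
qed

text \<open>
  From \<open>u(x)\<^sup>2 \<le> (u(x + y) - u(x))\<^sup>2 + 2 u(x) u(x + y)\<close>: after integration in \<open>x\<close> the first term is at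
  most \<open>\<rho>\<^sup>2\<close> times the Dirichlet integral for \<open>|y| < \<rho>\<close>, and averaging the second one over this ball
  gives at most the square of the \<open>L\<^sup>1\<close> norm, divided by the volume.
\<close>

lemma nash_ball:
  fixes u :: "'a::euclidean_space \<Rightarrow> real"
  assumes u: "C1_supp K u g" and r: "\<rho> > 0"
  shows "(\<integral>x. (u x)\<^sup>2 \<partial>lborel) \<le> \<rho>\<^sup>2 * (\<integral>x. (norm (g x))\<^sup>2 \<partial>lborel)
    + 2 / (\<rho> ^ DIM('a) * measure lborel (ball (0::'a) 1)) * (\<integral>x. \<bar>u x\<bar> \<partial>lborel)\<^sup>2"
proof -
  note [measurable] = C1_supp_measurable[OF u]
  define A where "A = (\<integral>x. (u x)\<^sup>2 \<partial>lborel)"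
  define B where "B = (\<integral>x. (norm (g x))\<^sup>2 \<partial>lborel)"
  define L where "L = (\<integral>x. \<bar>u x\<bar> \<partial>lborel)"
  define v where "v = measure lborel (ball (0::'a) \<rho>)"
  have nonneg: "A \<ge> 0" "B \<ge> 0" "L \<ge> 0" by (auto simp: A_def B_def L_def)
  have v: "emeasure lborel (ball (0::'a) \<rho>) = ennreal v" "v > 0"
    using emeasure_lborel_ball_finite[of "0::'a" \<rho>] content_ball_pos[OF r, of "0::'a"]
    by (auto simp: v_def emeasure_eq_ennreal_measure)
  have 1: "ennreal A \<le> ennreal (\<rho>\<^sup>2 * B) + 2 * (\<integral>\<^sup>+x. ennreal \<bar>u x\<bar> * ennreal \<bar>u (x + y)\<bar> \<partial>lborel)"
    if "y \<in> ball 0 \<rho>" for y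
  proof -
    have "ennreal A = (\<integral>\<^sup>+x. ennreal ((u x)\<^sup>2) \<partial>lborel)"
      unfolding A_def using C1_supp_integrables(2)[OF u] by (subst nn_integral_eq_integral) auto
    also have "\<dots> \<le> (\<integral>\<^sup>+x. ennreal ((u (x + y) - u x)\<^sup>2) + 2 * (ennreal \<bar>u x\<bar> * ennreal \<bar>u (x + y)\<bar>) \<partial>lborel)"
    proof (rule nn_integral_mono)
      fix x
      have "(u x)\<^sup>2 \<le> (u (x + y) - u x)\<^sup>2 + 2 * (u x * u (x + y))"
        by (simp add: power2_diff algebra_simps)
      also have "u x * u (x + y) \<le> \<bar>u x\<bar> * \<bar>u (x + y)\<bar>"
        by (metis abs_ge_self abs_mult)
      finally have "(u x)\<^sup>2 \<le> (u (x + y) - u x)\<^sup>2 + 2 * (\<bar>u x\<bar> * \<bar>u (x + y)\<bar>)" by simp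
      then show "ennreal ((u x)\<^sup>2) \<le> ennreal ((u (x + y) - u x)\<^sup>2) + 2 * (ennreal \<bar>u x\<bar> * ennreal \<bar>u (x + y)\<bar>)"
        by (auto dest!: ennreal_leI simp: ennreal_plus ennreal_mult)
    qed
    also have "\<dots> = (\<integral>\<^sup>+x. ennreal ((u (x + y) - u x)\<^sup>2) \<partial>lborel) + 2 * (\<integral>\<^sup>+x. ennreal \<bar>u x\<bar> * ennreal \<bar>u (x + y)\<bar> \<partial>lborel)"
      by (subst nn_integral_add) (auto simp: nn_integral_cmult)
    also have "(\<integral>\<^sup>+x. ennreal ((u (x + y) - u x)\<^sup>2) \<partial>lborel) \<le> ennreal ((norm y)\<^sup>2 * B)"
      unfolding B_def by (rule translation_difference_L2[OF u])
    also have "\<dots> \<le> ennreal (\<rho>\<^sup>2 * B)"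
      using that nonneg by (intro ennreal_leI mult_right_mono power_mono) auto
    finally show ?thesis by (simp add: add_right_mono)
  qed
  have [measurable]: "ball (0::'a) \<rho> \<in> sets borel" by simp
  have ind: "(\<integral>\<^sup>+y. indicator (ball (0::'a) \<rho>) y * c \<partial>lborel) = ennreal v * c" for c
    using v(1) by (subst nn_integral_multc) auto
  have "ennreal (A * v) = (\<integral>\<^sup>+y. indicator (ball (0::'a) \<rho>) y * ennreal A \<partial>lborel)"
    unfolding ind using nonneg v by (simp add: ennreal_mult mult.commute)
  also have "\<dots> \<le> (\<integral>\<^sup>+y. indicator (ball (0::'a) \<rho>) y * ennreal (\<rho>\<^sup>2 * B)
      + 2 * (\<integral>\<^sup>+x. ennreal \<bar>u x\<bar> * ennreal \<bar>u (x + y)\<bar> \<partial>lborel) \<partial>lborel)"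
    using 1 by (intro nn_integral_mono) (auto simp: indicator_def)
  also have "\<dots> = ennreal (\<rho>\<^sup>2 * B * v) + 2 * (\<integral>\<^sup>+y. \<integral>\<^sup>+x. ennreal \<bar>u x\<bar> * ennreal \<bar>u (x + y)\<bar> \<partial>lborel \<partial>lborel)"
    using nonneg v
    by (subst nn_integral_add) (simp_all add: nn_integral_cmult ind ennreal_mult mult_ac)
  also have "(\<integral>\<^sup>+y. \<integral>\<^sup>+x. ennreal \<bar>u x\<bar> * ennreal \<bar>u (x + y)\<bar> \<partial>lborel \<partial>lborel)
    = (\<integral>\<^sup>+x. \<integral>\<^sup>+y. ennreal \<bar>u x\<bar> * ennreal \<bar>u (x + y)\<bar> \<partial>lborel \<partial>lborel)"
    by (rule lborel_pair.Fubini') measurable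
  also have "\<dots> = (\<integral>\<^sup>+x. ennreal \<bar>u x\<bar> * ennreal L \<partial>lborel)"
  proof (rule nn_integral_cong)
    fix x
    have "(\<integral>\<^sup>+y. ennreal \<bar>u x\<bar> * ennreal \<bar>u (x + y)\<bar> \<partial>lborel) = ennreal \<bar>u x\<bar> * (\<integral>\<^sup>+y. ennreal \<bar>u (y + x)\<bar> \<partial>lborel)"
      by (subst nn_integral_cmult) (auto simp: add.commute)
    also have "(\<integral>\<^sup>+y. ennreal \<bar>u (y + x)\<bar> \<partial>lborel) = (\<integral>\<^sup>+y. ennreal \<bar>u y\<bar> \<partial>lborel)"
      by (rule nn_integral_translate[of "\<lambda>y. ennreal \<bar>u y\<bar>"]) measurable
    also have "\<dots> = ennreal L"
      unfolding L_def using C1_supp_integrables(3)[OF u] by (subst nn_integral_eq_integral) auto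
    finally show "(\<integral>\<^sup>+y. ennreal \<bar>u x\<bar> * ennreal \<bar>u (x + y)\<bar> \<partial>lborel) = ennreal \<bar>u x\<bar> * ennreal L" .
  qed
  also have "\<dots> = ennreal L * ennreal L"
    unfolding L_def using C1_supp_integrables(3)[OF u]
    by (subst nn_integral_multc) (auto simp: nn_integral_eq_integral)
  also have "ennreal (\<rho>\<^sup>2 * B * v) + 2 * (ennreal L * ennreal L) = ennreal (\<rho>\<^sup>2 * B * v + 2 * L\<^sup>2)"
    using nonneg v by (simp add: ennreal_plus ennreal_mult power2_eq_square)
  finally have "A * v \<le> \<rho>\<^sup>2 * B * v + 2 * L\<^sup>2"
    using nonneg v by (subst (asm) ennreal_le_iff) auto
  then have "A \<le> \<rho>\<^sup>2 * B + 2 / v * L\<^sup>2"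
    using v(2) by (simp add: field_simps)
  moreover have "v = \<rho> ^ DIM('a) * measure lborel (ball (0::'a) 1)"
    unfolding v_def using r content_ball_conv_unit_ball[of \<rho> "0::'a"] by simp
  ultimately show ?thesis by (simp add: A_def B_def L_def)
qed

section \<open>A smooth step\<close>

text \<open>
  A quadratic spline that rises from 0 to 1 on the unit interval. Written with positive parts it
  needs only the derivative of the square of the positive part to be seen to be \<open>C\<^sup>1\<close>.
\<close>

definition smoothstep :: "real \<Rightarrow> real" where
  "smoothstep z = 2 * ((max 0 z)\<^sup>2 - 2 * (max 0 (z - 1/2))\<^sup>2 + (max 0 (z - 1))\<^sup>2)"

definition smoothstep' :: "real \<Rightarrow> real" where
  "smoothstep' z = 4 * (max 0 z - 2 * max 0 (z - 1/2) + max 0 (z - 1))"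

lemma DERIV_pos_part_square: "((\<lambda>z::real. (max 0 z)\<^sup>2) has_real_derivative 2 * max 0 z) (at z)"
proof -
  consider "z > 0" | "z < 0" | "z = 0" by linarith
  then show ?thesis
  proof cases
    case 1
    have "((\<lambda>z::real. z\<^sup>2) has_real_derivative 2 * max 0 z) (at z)"
      using 1 by (auto intro!: derivative_eq_intros)
    then show ?thesis
      using 1 by (rule_tac has_field_derivative_transform_within_open[of _ _ _ "{0<..}"]) auto
  next
    case 2
    have "((\<lambda>z::real. 0) has_real_derivative 2 * max 0 z) (at z)"
      using 2 by (auto intro!: derivative_eq_intros)
    then show ?thesis
      using 2 by (rule_tac has_field_derivative_transform_within_open[of _ _ _ "{..<0}"]) auto
  next
    case 3
    have "((\<lambda>h. (max 0 h)\<^sup>2 / h) \<longlongrightarrow> 0) (at (0::real))"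
    proof (rule Lim_null_comparison)
      show "eventually (\<lambda>h. norm ((max 0 h)\<^sup>2 / h) \<le> \<bar>h\<bar>) (at (0::real))"
        by (rule always_eventually) (auto simp: max_def power2_eq_square)
    qed (auto intro!: tendsto_eq_intros)
    then show ?thesis using 3 by (simp add: DERIV_def)
  qed
qed

lemma DERIV_smoothstep:
  "(smoothstep has_real_derivative smoothstep' z) (at z)"
proof -
  have d: "((\<lambda>z::real. (max 0 (z - c))\<^sup>2) has_real_derivative 2 * max 0 (z - c)) (at z)" for c
  proof -
    have "((\<lambda>z. z - c) has_real_derivative 1) (at z)"
      by (auto intro!: derivative_eq_intros)
    from DERIV_chain2[where g="\<lambda>z. z - c", OF DERIV_pos_part_square this] show ?thesis by simp
  qed
  show ?thesis
    unfolding smoothstep_def[abs_def] smoothstep'_def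
    using DERIV_cmult[OF DERIV_add[OF DERIV_diff[OF DERIV_pos_part_square
      DERIV_cmult[OF d[of "1/2"], of 2]] d[of 1]], of 2]
    by (simp add: algebra_simps)
qed

lemma continuous_smoothstep': "continuous_on S smoothstep'"
  unfolding smoothstep'_def[abs_def] by (intro continuous_intros)

lemma smoothstep_le: "z \<le> 0 \<Longrightarrow> smoothstep z = 0" "z \<ge> 1 \<Longrightarrow> smoothstep z = 1"
  by (auto simp: smoothstep_def max_def power2_eq_square algebra_simps)

lemma smoothstep'_zero: "z \<le> 0 \<or> z \<ge> 1 \<Longrightarrow> smoothstep' z = 0"
  by (auto simp: smoothstep'_def max_def)

lemma smoothstep'_bounds: "0 \<le> smoothstep' z" "smoothstep' z \<le> 2"
  by (auto simp: smoothstep'_def max_def)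

lemma smoothstep_bounds: "0 \<le> smoothstep z" "smoothstep z \<le> 1"
proof -
  have "0 \<le> smoothstep z \<and> smoothstep z \<le> 1"
  proof -
    consider "z \<le> 0" | "z \<ge> 1" | "0 \<le> z" "z \<le> 1/2" | "1/2 \<le> z" "z \<le> 1" by linarith
    then show ?thesis
    proof cases
      case 3
      then have "smoothstep z = 2 * z\<^sup>2" by (simp add: smoothstep_def max_def)
      moreover have "z\<^sup>2 \<le> (1/2)\<^sup>2" using 3 by (intro power_mono) auto
      ultimately show ?thesis by (simp add: power2_eq_square)
    next
      case 4
      then have "smoothstep z = 1 - 2 * (1 - z)\<^sup>2"
        by (auto simp: smoothstep_def max_def power2_eq_square algebra_simps)
      moreover have "(1 - z)\<^sup>2 \<le> (1/2)\<^sup>2" using 4 by (intro power_mono) auto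
      ultimately show ?thesis by (simp add: power2_eq_square)
    qed (auto simp: smoothstep_le)
  qed
  then show "0 \<le> smoothstep z" "smoothstep z \<le> 1" by auto
qed

section \<open>The Sobolev inequality by truncation\<close>

text \<open>
  An even function that vanishes for \<open>|t| \<le> 1\<close> and equals 1 for \<open>|t| \<ge> 2\<close>, so that \<open>t * level_cut (u / t)\<close>
  truncates \<open>|u|\<close> between the levels \<open>t\<close> and \<open>2 t\<close>. Using \<open>t\<^sup>2\<close> avoids the corner of the absolute value.
\<close>

definition level_cut :: "real \<Rightarrow> real" where
  "level_cut t = smoothstep ((t\<^sup>2 - 1) / 3)"

definition level_cut' :: "real \<Rightarrow> real" where
  "level_cut' t = smoothstep' ((t\<^sup>2 - 1) / 3) * (2 * t / 3)"

lemma DERIV_level_cut: "(level_cut has_real_derivative level_cut' t) (at t)"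
proof -
  have "((\<lambda>t::real. (t\<^sup>2 - 1) / 3) has_real_derivative 2 * t / 3) (at t)"
    by (auto intro!: derivative_eq_intros)
  from DERIV_chain2[where g="\<lambda>t. (t\<^sup>2 - 1) / 3", OF DERIV_smoothstep this]
  show ?thesis by (simp add: level_cut_def[abs_def] level_cut'_def)
qed

lemma continuous_level_cut': "continuous_on UNIV level_cut'"
  unfolding level_cut'_def[abs_def]
  by (intro continuous_intros continuous_on_compose2[OF continuous_smoothstep'[of UNIV]]) auto

lemma level_cut_low: "\<bar>t\<bar> \<le> 1 \<Longrightarrow> level_cut t = 0"
  by (simp add: level_cut_def smoothstep_le abs_square_le_1)

lemma level_cut_high:
  assumes "\<bar>t\<bar> \<ge> 2" shows "level_cut t = 1"
proof -
  have "2\<^sup>2 \<le> \<bar>t\<bar>\<^sup>2" using assms by (intro power_mono) auto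
  then show ?thesis by (simp add: level_cut_def smoothstep_le)
qed

lemma level_cut_bounds: "0 \<le> level_cut t" "level_cut t \<le> 1"
  by (auto simp: level_cut_def smoothstep_bounds)

lemma level_cut'_zero:
  assumes "\<bar>t\<bar> \<le> 1 \<or> \<bar>t\<bar> \<ge> 2" shows "level_cut' t = 0"
proof -
  have "2\<^sup>2 \<le> \<bar>t\<bar>\<^sup>2" if "\<bar>t\<bar> \<ge> 2" using that by (intro power_mono) auto
  moreover have "t\<^sup>2 \<le> 1" if "\<bar>t\<bar> \<le> 1" using that by (simp add: abs_square_le_1)
  ultimately have "(t\<^sup>2 - 1) / 3 \<le> 0 \<or> (t\<^sup>2 - 1) / 3 \<ge> 1" using assms by auto
  then show ?thesis by (simp add: level_cut'_def smoothstep'_zero)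
qed

text \<open>
  The inequalities on the right are strict, so the bands of distinct dyadic levels are disjoint.
\<close>

lemma level_cut'_square: "(level_cut' t)\<^sup>2 \<le> 9 * (if 1 < \<bar>t\<bar> \<and> \<bar>t\<bar> < 2 then 1 else 0)"
proof (cases "1 < \<bar>t\<bar> \<and> \<bar>t\<bar> < 2")
  case True
  have "\<bar>level_cut' t\<bar> = smoothstep' ((t\<^sup>2 - 1) / 3) * (2 * \<bar>t\<bar> / 3)"
    by (simp add: level_cut'_def abs_mult smoothstep'_bounds)
  also have "\<dots> \<le> 2 * (2 * 2 / 3)"
    using True by (intro mult_mono) (auto simp: smoothstep'_bounds)
  finally have "\<bar>level_cut' t\<bar> \<le> 3" by simp
  then have "\<bar>level_cut' t\<bar>\<^sup>2 \<le> 3\<^sup>2" by (intro power_mono) auto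
  then show ?thesis using True by simp
next
  case False
  then show ?thesis by (auto simp: level_cut'_zero)
qed

context
  fixes K :: "'a::euclidean_space set" and u :: "'a \<Rightarrow> real" and g :: "'a \<Rightarrow> 'a"
  assumes u: "C1_supp K u g"
begin

definition superlevel :: "real \<Rightarrow> real" where
  "superlevel t = measure lborel {x. t \<le> \<bar>u x\<bar>}"

definition band_energy :: "real \<Rightarrow> real" where
  "band_energy t = (\<integral>x. indicator {x. t < \<bar>u x\<bar> \<and> \<bar>u x\<bar> < 2 * t} x * (norm (g x))\<^sup>2 \<partial>lborel)"

lemma superlevel_sets:
  assumes "t > 0"
  shows "{x. t \<le> \<bar>u x\<bar>} \<in> sets lborel" "emeasure lborel {x. t \<le> \<bar>u x\<bar>} < \<infinity>"
proof -
  have "{x. t \<le> \<bar>u x\<bar>} \<subseteq> K"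
    using assms C1_supp_zero[OF u] by force
  then have "bounded {x. t \<le> \<bar>u x\<bar>}"
    using C1_supp_compact[OF u] bounded_subset compact_imp_bounded by blast
  then show "emeasure lborel {x. t \<le> \<bar>u x\<bar>} < \<infinity>" by (rule emeasure_bounded_finite)
  note [measurable] = C1_supp_measurable[OF u]
  show "{x. t \<le> \<bar>u x\<bar>} \<in> sets lborel" by measurable
qed

lemma integrable_superlevel: "t > 0 \<Longrightarrow> integrable lborel (indicat_real {x. t \<le> \<bar>u x\<bar>})"
  using superlevel_sets[of t] by (simp add: integrable_indicator_iff)

lemma integral_superlevel: "t > 0 \<Longrightarrow> (\<integral>x. indicator {x. t \<le> \<bar>u x\<bar>} x \<partial>lborel) = superlevel t"
  by (simp add: superlevel_def)

lemma integrable_band: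
  "integrable lborel (\<lambda>x. indicator {x. t < \<bar>u x\<bar> \<and> \<bar>u x\<bar> < 2 * t} x * (norm (g x))\<^sup>2)"
proof -
  note [measurable] = C1_supp_measurable[OF u]
  show ?thesis
    by (rule Bochner_Integration.integrable_bound[OF C1_supp_integrables(1)[OF u]])
      (auto simp: indicator_def)
qed

text \<open>
  The Nash-type inequality for the truncation of \<open>u\<close> between the levels \<open>t\<close> and \<open>2 t\<close>.
\<close>

lemma nash_level:
  assumes t: "t > 0" and r: "\<rho> > 0"
  shows "t\<^sup>2 * superlevel (2 * t) \<le> 9 * \<rho>\<^sup>2 * band_energy t
    + 2 / (\<rho> ^ DIM('a) * measure lborel (ball (0::'a) 1)) * (t * superlevel t)\<^sup>2"
proof -
  define v where "v x = t * level_cut (u x / t)" for x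
  define w where "w x = level_cut' (u x / t) *\<^sub>R g x" for x
  have v: "C1_supp K v w"
    unfolding v_def w_def
  proof (rule C1_supp_compose[OF u, of "\<lambda>s. t * level_cut (s / t)" "\<lambda>s. level_cut' (s / t)"])
    fix s
    have "((\<lambda>s. s / t) has_real_derivative 1 / t) (at s)"
      using t by (auto intro!: derivative_eq_intros)
    from DERIV_cmult[OF DERIV_chain2[where g="\<lambda>s. s / t", OF DERIV_level_cut this], of t] t
    show "((\<lambda>s. t * level_cut (s / t)) has_real_derivative level_cut' (s / t)) (at s)" by simp
    show "continuous_on UNIV (\<lambda>s. level_cut' (s / t))"
      by (intro continuous_intros continuous_on_compose2[OF continuous_level_cut']) (use t in auto)
  qed (simp add: level_cut_low)
  have div: "\<bar>u x / t\<bar> = \<bar>u x\<bar> / t" for x using t by simp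
  have "(\<integral>x. (norm (w x))\<^sup>2 \<partial>lborel) \<le> (\<integral>x. 9 * (indicator {x. t < \<bar>u x\<bar> \<and> \<bar>u x\<bar> < 2 * t} x * (norm (g x))\<^sup>2) \<partial>lborel)"
  proof (rule integral_mono[OF C1_supp_integrables(1)[OF v]])
    show "integrable lborel (\<lambda>x. 9 * (indicator {x. t < \<bar>u x\<bar> \<and> \<bar>u x\<bar> < 2 * t} x * (norm (g x))\<^sup>2))"
      using integrable_band by (rule integrable_mult_right)
    fix x
    have "(norm (w x))\<^sup>2 = (level_cut' (u x / t))\<^sup>2 * (norm (g x))\<^sup>2"
      by (simp add: w_def power_mult_distrib)
    also have "\<dots> \<le> (9 * (if 1 < \<bar>u x / t\<bar> \<and> \<bar>u x / t\<bar> < 2 then 1 else 0)) * (norm (g x))\<^sup>2"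
      by (rule mult_right_mono[OF level_cut'_square]) simp
    finally show "(norm (w x))\<^sup>2 \<le> 9 * (indicator {x. t < \<bar>u x\<bar> \<and> \<bar>u x\<bar> < 2 * t} x * (norm (g x))\<^sup>2)"
      using t unfolding div by (simp add: indicator_def pos_less_divide_eq pos_divide_less_eq split: if_splits)
  qed
  then have W: "(\<integral>x. (norm (w x))\<^sup>2 \<partial>lborel) \<le> 9 * band_energy t"
    by (simp add: band_energy_def)
  have L: "(\<integral>x. \<bar>v x\<bar> \<partial>lborel)\<^sup>2 \<le> (t * superlevel t)\<^sup>2"
  proof (rule power_mono)
    have "(\<integral>x. \<bar>v x\<bar> \<partial>lborel) \<le> (\<integral>x. t * indicator {x. t \<le> \<bar>u x\<bar>} x \<partial>lborel)"
    proof (rule integral_mono[OF C1_supp_integrables(3)[OF v]])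
      show "integrable lborel (\<lambda>x. t * indicat_real {x. t \<le> \<bar>u x\<bar>} x)"
        using integrable_superlevel[of t] t by simp
      fix x
      show "\<bar>v x\<bar> \<le> t * indicat_real {x. t \<le> \<bar>u x\<bar>} x"
        using level_cut_low[of "u x / t"] level_cut_bounds[of "u x / t"] t unfolding div
        by (auto simp: v_def indicator_def abs_mult pos_divide_le_eq)
    qed
    also have "\<dots> = t * superlevel t"
      using t by (simp add: integral_superlevel[symmetric])
    finally show "(\<integral>x. \<bar>v x\<bar> \<partial>lborel) \<le> t * superlevel t" .
  qed simp
  have "t\<^sup>2 * superlevel (2 * t) = (\<integral>x. t\<^sup>2 * indicator {x. 2 * t \<le> \<bar>u x\<bar>} x \<partial>lborel)"
    using t by (simp add: integral_superlevel[symmetric])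
  also have "\<dots> \<le> (\<integral>x. (v x)\<^sup>2 \<partial>lborel)"
  proof (rule integral_mono)
    show "integrable lborel (\<lambda>x. t\<^sup>2 * indicat_real {x. 2 * t \<le> \<bar>u x\<bar>} x)"
      using integrable_superlevel[of "2 * t"] t by simp
    show "t\<^sup>2 * indicat_real {x. 2 * t \<le> \<bar>u x\<bar>} x \<le> (v x)\<^sup>2" for x
      using level_cut_high[of "u x / t"] t unfolding div by (auto simp: indicator_def v_def pos_le_divide_eq)
  qed (rule C1_supp_integrables[OF v])
  also have "\<dots> \<le> \<rho>\<^sup>2 * (\<integral>x. (norm (w x))\<^sup>2 \<partial>lborel)
    + 2 / (\<rho> ^ DIM('a) * measure lborel (ball (0::'a) 1)) * (\<integral>x. \<bar>v x\<bar> \<partial>lborel)\<^sup>2"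
    by (rule nash_ball[OF v r])
  also have "\<dots> \<le> \<rho>\<^sup>2 * (9 * band_energy t)
    + 2 / (\<rho> ^ DIM('a) * measure lborel (ball (0::'a) 1)) * (t * superlevel t)\<^sup>2"
    using r by (intro add_mono mult_left_mono W L) auto
  finally show ?thesis by (simp add: mult_ac)
qed

lemma superlevel_nonneg: "superlevel t \<ge> 0"
  by (simp add: superlevel_def)

lemma superlevel_antimono:
  assumes "0 < s" "s \<le> t" shows "superlevel t \<le> superlevel s"
  unfolding superlevel_def using assms superlevel_sets[of s] superlevel_sets[of t]
  by (intro measure_mono_fmeasurable) (auto simp: fmeasurable_def)

lemma band_energy_nonneg: "band_energy t \<ge> 0"
  unfolding band_energy_def by (intro integral_nonneg_AE AE_I2) (auto simp: indicator_def)

text \<open>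
  The radius is chosen so that its \<open>n\<close>-th power is proportional to the measure of the superlevel set. The last
  term is then linear in that measure and, for small \<open>\<epsilon>\<close>, can be absorbed after summation.
\<close>

lemma nash_level_optimized:
  assumes t: "t > 0" and \<epsilon>: "\<epsilon> > 0"
  defines "C \<equiv> 9 * (2 / (measure lborel (ball (0::'a) 1) * \<epsilon>)) powr (2 / real DIM('a))"
  shows "t\<^sup>2 * superlevel (2 * t)
    \<le> C * superlevel t powr (2 / real DIM('a)) * band_energy t + \<epsilon> * (t\<^sup>2 * superlevel t)"
proof (cases "superlevel t = 0")
  case True
  then have "superlevel (2 * t) = 0"
    using superlevel_antimono[of t "2 * t"] superlevel_nonneg[of "2 * t"] t by simp
  then show ?thesis using True by simp
next
  case False
  then have a: "superlevel t > 0" using superlevel_nonneg[of t] by simp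
  define \<omega> where "\<omega> = measure lborel (ball (0::'a) 1)"
  have \<omega>: "\<omega> > 0" unfolding \<omega>_def by (rule content_ball_pos) simp
  define m where "m = 2 / (\<omega> * \<epsilon>) * superlevel t"
  have m: "m > 0" using \<omega> \<epsilon> a by (simp add: m_def)
  define \<rho> where "\<rho> = m powr (1 / real DIM('a))"
  have \<rho>: "\<rho> > 0" using m by (simp add: \<rho>_def)
  have \<rho>n: "\<rho> ^ DIM('a) = m"
    using m by (simp add: \<rho>_def powr_realpow[symmetric] powr_powr)
  have \<rho>2: "\<rho>\<^sup>2 = m powr (2 / real DIM('a))"
    using m \<rho> by (simp add: \<rho>_def powr_realpow[symmetric] powr_powr)
  also have "\<dots> = (2 / (\<omega> * \<epsilon>)) powr (2 / real DIM('a)) * superlevel t powr (2 / real DIM('a))"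
    unfolding m_def using \<omega> \<epsilon> a by (subst powr_mult) auto
  finally have "9 * \<rho>\<^sup>2 * band_energy t = C * superlevel t powr (2 / real DIM('a)) * band_energy t"
    by (simp add: C_def \<omega>_def)
  moreover have "2 / (\<rho> ^ DIM('a) * \<omega>) * (t * superlevel t)\<^sup>2 = \<epsilon> * (t\<^sup>2 * superlevel t)"
    unfolding \<rho>n m_def using \<omega> \<epsilon> a by (simp add: field_simps power2_eq_square)
  ultimately show ?thesis
    using nash_level[OF t \<rho>] unfolding \<omega>_def by linarith
qed

end

text \<open>
  The first of three elementary sums by which \<open>\<integral>|u| powr q\<close> and the Dirichlet integral are compared
  with their dyadic counterparts. Starting at the level \<open>\<delta>\<close> keeps the sums finite, at the price of the
  first term on the right, which disappears as \<open>\<delta>\<close> tends to zero.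
\<close>

lemma dyadic_power_le:
  fixes q s \<delta> :: real
  assumes q: "q \<ge> 1" and \<delta>: "\<delta> > 0" and s: "s \<ge> 0"
  defines "t \<equiv> \<lambda>k. \<delta> * 2 ^ k"
  shows "s \<le> 2 * t N \<Longrightarrow>
    s powr q \<le> (2 * \<delta>) powr q + (\<Sum>k<N. 4 powr q * (t k powr q * (if 2 * t k \<le> s then 1 else 0)))"
proof (induction N)
  case 0
  then show ?case using s q by (simp add: t_def powr_mono2)
next
  case (Suc N)
  have pos: "0 \<le> (\<Sum>k<N. 4 powr q * (t k powr q * (if 2 * t k \<le> s then 1 else 0)))"
    by (intro sum_nonneg) auto
  show ?case
  proof (cases "s \<le> 2 * t N")
    case True
    have "0 \<le> 4 powr q * (t N powr q * (if 2 * t N \<le> s then 1 else 0))" by simp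
    then show ?thesis using Suc.IH[OF True] unfolding sum.lessThan_Suc by linarith
  next
    case False
    have "s powr q \<le> (4 * t N) powr q"
      using Suc.prems s q by (intro powr_mono2) (auto simp: t_def)
    also have "\<dots> = 4 powr q * t N powr q"
      using \<delta> by (simp add: t_def powr_mult)
    finally show ?thesis using False pos by (simp add: add_increasing)
  qed
qed

lemma dyadic_bands_disjoint:
  fixes s \<delta> :: real
  assumes \<delta>: "\<delta> > 0"
  defines "t \<equiv> \<lambda>k. \<delta> * 2 ^ k"
  shows "(\<Sum>k<N. if t k < s \<and> s < 2 * t k then 1 else 0) \<le> (if s < t N then 1 else (0::real))"
proof (induction N)
  case (Suc N)
  have "t (Suc N) = 2 * t N" "t N > 0" using \<delta> by (simp_all add: t_def)
  then show ?case using Suc by (auto split: if_splits)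
qed simp

lemma dyadic_powers_sum_le:
  fixes q s \<delta> :: real
  assumes q: "q \<ge> 1" and \<delta>: "\<delta> > 0"
  defines "t \<equiv> \<lambda>k. \<delta> * 2 ^ k"
  shows "(\<Sum>k<N. t k powr q * (if t k \<le> s then 1 else 0)) \<le> 2 * s powr q"
proof -
  have tpos: "t k > 0" for k using \<delta> by (simp add: t_def)
  have geo: "(\<Sum>k\<le>N. t k powr q) \<le> 2 * t N powr q" for N
  proof (induction N)
    case (Suc N)
    have "2 * t N powr q \<le> 2 powr q * t N powr q"
      using powr_mono[OF q, of 2] by (intro mult_right_mono) auto
    also have "\<dots> = t (Suc N) powr q"
      using tpos[of N] by (simp add: t_def powr_mult[symmetric] mult_ac)
    finally show ?case using Suc by simp
  qed simp
  show ?thesis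
  proof (induction N)
    case (Suc N)
    show ?case
    proof (cases "t N \<le> s")
      case True
      have "(\<Sum>k<Suc N. t k powr q * (if t k \<le> s then 1 else 0)) \<le> (\<Sum>k<Suc N. t k powr q)"
        by (intro sum_mono) auto
      also have "\<dots> \<le> 2 * t N powr q"
        using geo[of N] by (simp add: lessThan_Suc_atMost)
      also have "\<dots> \<le> 2 * s powr q"
        using True tpos[of N] q by (intro mult_left_mono powr_mono2) auto
      finally show ?thesis .
    next
      case False
      then show ?thesis using Suc by simp
    qed
  qed simp
qed

lemma C1_supp_integrable_powr:
  assumes u: "C1_supp K u g" and q: "q > 0"
  shows "integrable lborel (\<lambda>x. \<bar>u x\<bar> powr q)"
proof (rule integrable_supp[OF u])
  show "continuous_on K (\<lambda>x. \<bar>u x\<bar> powr q)"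
    by (rule continuous_on_powr') (use q in \<open>auto intro!: continuous_intros C1_supp_cont[OF u]\<close>)
qed (simp add: C1_supp_zero[OF u])

text \<open>
  Let \<open>I = \<integral>|u| powr q\<close>, \<open>a(t)\<close> the measure of \<open>|u| \<ge> t\<close>, and multiply the inequality for the level \<open>t\<close>
  by \<open>t powr (q - 2)\<close>. Since \<open>q - 2 = 2 q / n\<close>, the factor in front of the band energy becomes
  \<open>(t powr q * a(t)) powr (2 / n) \<le> I powr (2 / n)\<close> by Chebyshev's inequality. Summing over dyadic levels
  and absorbing the last term gives \<open>I \<le> C I powr (2 / n) \<integral>|\<nabla>u|\<^sup>2\<close>.
\<close>

theorem sobolev_inequality:
  assumes n: "DIM('a::euclidean_space) \<ge> 3"
  defines "q \<equiv> 2 * real DIM('a) / (real DIM('a) - 2)"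
  obtains S where "S > 0" "\<And>K (u :: 'a \<Rightarrow> real) g. C1_supp K u g \<Longrightarrow>
    (\<integral>x. \<bar>u x\<bar> powr q \<partial>lborel) powr ((real DIM('a) - 2) / real DIM('a)) \<le> S * (\<integral>x. (norm (g x))\<^sup>2 \<partial>lborel)"
proof -
  define n where "n = real DIM('a)"
  have n3: "n \<ge> 3" using n by (simp add: n_def)
  have q: "q = 2 * n / (n - 2)" by (simp add: q_def n_def)
  have q1: "q \<ge> 1" "q > 0" unfolding q using n3 by (simp_all add: field_simps)
  have qn: "q - 2 = q * (2 / n)" unfolding q using n3 by (simp add: field_simps)
  \<comment> \<open>Summing the absorbed terms costs \<open>4 powr q * 2\<close>; this choice turns them into \<open>I / 2\<close>.\<close>
  define \<epsilon> where "\<epsilon> = 1 / (4 * 4 powr q)"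
  have \<epsilon>: "\<epsilon> > 0" by (simp add: \<epsilon>_def)
  define C where "C = 9 * (2 / (measure lborel (ball (0::'a) 1) * \<epsilon>)) powr (2 / n)"
  have "measure lborel (ball (0::'a) 1) > 0" by (rule content_ball_pos) simp
  then have C: "C > 0" using \<epsilon> by (simp add: C_def)
  show thesis
  proof (rule that[of "2 * 4 powr q * C"])
    show "2 * 4 powr q * C > 0" using C by simp
    fix K and u :: "'a \<Rightarrow> real" and g
    assume u: "C1_supp K u g"
    note [measurable] = C1_supp_measurable[OF u]
    define I where "I = (\<integral>x. \<bar>u x\<bar> powr q \<partial>lborel)"
    define B where "B = (\<integral>x. (norm (g x))\<^sup>2 \<partial>lborel)"
    have I0: "I \<ge> 0" and B0: "B \<ge> 0" by (simp_all add: I_def B_def)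
    let ?a = "superlevel u" and ?b = "band_energy u g"
    have Ii: "integrable lborel (\<lambda>x. \<bar>u x\<bar> powr q)"
      by (rule C1_supp_integrable_powr[OF u q1(2)])
    have bK: "bounded (u ` K)"
      by (meson u C1_supp_compact C1_supp_cont compact_continuous_image compact_imp_bounded)
    then obtain M where M: "\<And>x. x \<in> K \<Longrightarrow> \<bar>u x\<bar> \<le> M" by (auto simp: bounded_iff)
    have Ki: "integrable lborel (indicat_real K)"
      using emeasure_compact_finite[OF C1_supp_compact[OF u]] C1_supp_compact[OF u]
      by (simp add: integrable_indicator_iff borel_compact)
    have cheb: "t powr q * ?a t \<le> I" if "t > 0" for t
    proof -
      have "t powr q * ?a t = (\<integral>x. t powr q * indicator {x. t \<le> \<bar>u x\<bar>} x \<partial>lborel)"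
        using that by (simp add: integral_superlevel[OF u, symmetric])
      also have "\<dots> \<le> I" unfolding I_def
      proof (rule integral_mono[OF _ Ii])
        show "integrable lborel (\<lambda>x. t powr q * indicat_real {x. t \<le> \<bar>u x\<bar>} x)"
          using integrable_superlevel[OF u that] by simp
      qed (use that q1 in \<open>auto simp: indicator_def intro!: powr_mono2\<close>)
      finally show ?thesis .
    qed
    have main: "I / 2 \<le> (2 * \<delta>) powr q * measure lborel K + 4 powr q * C * I powr (2 / n) * B"
      if \<delta>: "\<delta> > 0" for \<delta>
    proof -
      define t where "t k = \<delta> * 2 ^ k" for k :: nat
      have t: "t k > 0" "2 * t k > 0" for k using \<delta> by (auto simp: t_def)
      \<comment> \<open>No more levels are needed, since \<open>|u| \<le> M\<close> lies below the last one.\<close>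
      obtain N where "M / \<delta> < 2 ^ N" using real_arch_pow[of 2 "M / \<delta>"] by auto
      then have "M < t N" using \<delta> by (simp add: t_def field_simps)
      then have N: "M \<le> 2 * t N" using t[of N] by linarith
      have sl: "integrable lborel (\<lambda>x. t k powr q * indicat_real {x. 2 * t k \<le> \<bar>u x\<bar>} x)" for k
        using integrable_superlevel[OF u t(2)] by simp
      have b_le: "(\<Sum>k<N. ?b (t k)) \<le> B"
      proof -
        have "(\<Sum>k<N. ?b (t k)) = (\<integral>x. (\<Sum>k<N. indicator {x. t k < \<bar>u x\<bar> \<and> \<bar>u x\<bar> < 2 * t k} x * (norm (g x))\<^sup>2) \<partial>lborel)"
          unfolding band_energy_def[OF u]
          by (rule Bochner_Integration.integral_sum[symmetric]) (rule integrable_band[OF u])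
        also have "\<dots> \<le> B" unfolding B_def
        proof (rule integral_mono[OF _ C1_supp_integrables(1)[OF u]])
          show "integrable lborel (\<lambda>x. \<Sum>k<N. indicator {x. t k < \<bar>u x\<bar> \<and> \<bar>u x\<bar> < 2 * t k} x * (norm (g x))\<^sup>2)"
            by (rule Bochner_Integration.integrable_sum) (rule integrable_band[OF u])
          fix x
          have "(\<Sum>k<N. if t k < \<bar>u x\<bar> \<and> \<bar>u x\<bar> < 2 * t k then 1 else 0) \<le> (1::real)"
            using dyadic_bands_disjoint[OF \<delta>, where N=N and s="\<bar>u x\<bar>"] unfolding t_def by (auto split: if_splits)
          then have "(\<Sum>k<N. indicator {x. t k < \<bar>u x\<bar> \<and> \<bar>u x\<bar> < 2 * t k} x) \<le> (1::real)"
            unfolding indicator_def of_bool_def by simp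
          from mult_right_mono[OF this, of "(norm (g x))\<^sup>2"]
          show "(\<Sum>k<N. indicator {x. t k < \<bar>u x\<bar> \<and> \<bar>u x\<bar> < 2 * t k} x * (norm (g x))\<^sup>2) \<le> (norm (g x))\<^sup>2"
            by (simp add: sum_distrib_right)
        qed
        finally show ?thesis .
      qed
      have a_le: "(\<Sum>k<N. t k powr q * ?a (t k)) \<le> 2 * I"
      proof -
        have sl': "integrable lborel (\<lambda>x. t k powr q * indicat_real {x. t k \<le> \<bar>u x\<bar>} x)" for k
          using integrable_superlevel[OF u t(1)] by simp
        have "(\<Sum>k<N. t k powr q * ?a (t k)) = (\<Sum>k<N. \<integral>x. t k powr q * indicator {x. t k \<le> \<bar>u x\<bar>} x \<partial>lborel)"
          by (simp add: integral_superlevel[OF u t(1), symmetric])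
        also have "\<dots> = (\<integral>x. (\<Sum>k<N. t k powr q * indicator {x. t k \<le> \<bar>u x\<bar>} x) \<partial>lborel)"
          using sl' by (rule Bochner_Integration.integral_sum[symmetric])
        also have "\<dots> \<le> (\<integral>x. 2 * \<bar>u x\<bar> powr q \<partial>lborel)"
        proof (rule integral_mono)
          show "integrable lborel (\<lambda>x. \<Sum>k<N. t k powr q * indicat_real {x. t k \<le> \<bar>u x\<bar>} x)"
            using sl' by (rule Bochner_Integration.integrable_sum)
          show "integrable lborel (\<lambda>x. 2 * \<bar>u x\<bar> powr q)" using Ii by simp
          fix x
          show "(\<Sum>k<N. t k powr q * indicator {x. t k \<le> \<bar>u x\<bar>} x) \<le> 2 * \<bar>u x\<bar> powr q"
            using dyadic_powers_sum_le[OF q1(1) \<delta>, where N=N and s="\<bar>u x\<bar>"]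
            unfolding t_def indicator_def of_bool_def by simp
        qed
        finally show ?thesis by (simp add: I_def)
      qed
      have "I \<le> (\<integral>x. (2 * \<delta>) powr q * indicator K x
          + (\<Sum>k<N. 4 powr q * (t k powr q * indicator {x. 2 * t k \<le> \<bar>u x\<bar>} x)) \<partial>lborel)"
        unfolding I_def
      proof (rule integral_mono[OF Ii])
        show "integrable lborel (\<lambda>x. (2 * \<delta>) powr q * indicat_real K x
          + (\<Sum>k<N. 4 powr q * (t k powr q * indicat_real {x. 2 * t k \<le> \<bar>u x\<bar>} x)))"
          using Ki sl by (intro Bochner_Integration.integrable_add Bochner_Integration.integrable_sum integrable_mult_right) auto
        fix x
        show "\<bar>u x\<bar> powr q \<le> (2 * \<delta>) powr q * indicator K x
          + (\<Sum>k<N. 4 powr q * (t k powr q * indicator {x. 2 * t k \<le> \<bar>u x\<bar>} x))"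
        proof (cases "x \<in> K")
          case True
          then have "\<bar>u x\<bar> \<le> 2 * (\<delta> * 2 ^ N)" using M[OF True] N by (simp add: t_def)
          from dyadic_power_le[OF q1(1) \<delta> _ this] True show ?thesis
            unfolding t_def indicator_def of_bool_def by simp
        next
          case False
          then show ?thesis using q1 by (simp add: C1_supp_zero[OF u] sum_nonneg)
        qed
      qed
      also have "\<dots> = (2 * \<delta>) powr q * measure lborel K + (\<Sum>k<N. 4 powr q * (t k powr q * ?a (2 * t k)))"
        using Ki sl
        by (subst Bochner_Integration.integral_add)
          (auto simp: superlevel_def[OF u] integrable_superlevel[OF u t(2)])
      finally have I_le: "I \<le> (2 * \<delta>) powr q * measure lborel K + (\<Sum>k<N. 4 powr q * (t k powr q * ?a (2 * t k)))" .
      have "(\<Sum>k<N. 4 powr q * (t k powr q * ?a (2 * t k)))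
         \<le> (\<Sum>k<N. 4 powr q * (C * I powr (2 / n) * ?b (t k) + \<epsilon> * (t k powr q * ?a (t k))))"
      proof (intro sum_mono mult_left_mono)
        fix k
        have tq: "t k powr q = t k powr (q - 2) * (t k)\<^sup>2"
          using t[of k] by (simp add: powr_diff)
        have "t k powr q * ?a (2 * t k) = t k powr (q - 2) * ((t k)\<^sup>2 * ?a (2 * t k))"
          by (simp add: tq)
        also have "\<dots> \<le> t k powr (q - 2) * (C * ?a (t k) powr (2 / n) * ?b (t k) + \<epsilon> * ((t k)\<^sup>2 * ?a (t k)))"
          unfolding C_def n_def by (intro mult_left_mono nash_level_optimized[OF u t(1) \<epsilon>]) simp
        also have "\<dots> = C * (t k powr (q - 2) * ?a (t k) powr (2 / n)) * ?b (t k) + \<epsilon> * (t k powr q * ?a (t k))"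
          by (simp add: tq algebra_simps)
        also have "t k powr (q - 2) * ?a (t k) powr (2 / n) = (t k powr q * ?a (t k)) powr (2 / n)"
          using superlevel_nonneg[OF u] by (simp add: qn powr_mult powr_powr)
        also have "\<dots> \<le> I powr (2 / n)"
          using cheb[OF t(1)] superlevel_nonneg[OF u] n3 by (intro powr_mono2) auto
        finally show "t k powr q * ?a (2 * t k) \<le> C * I powr (2 / n) * ?b (t k) + \<epsilon> * (t k powr q * ?a (t k))"
          using C band_energy_nonneg[OF u] by (simp add: mult_left_mono mult_right_mono)
      qed simp
      also have "\<dots> = 4 powr q * C * I powr (2 / n) * (\<Sum>k<N. ?b (t k)) + (1/4) * (\<Sum>k<N. t k powr q * ?a (t k))"
        by (simp add: \<epsilon>_def sum.distrib sum_distrib_left algebra_simps)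
      also have "\<dots> \<le> 4 powr q * C * I powr (2 / n) * B + (1/4) * (2 * I)"
        using C by (intro add_mono mult_left_mono a_le b_le) auto
      finally show ?thesis using I_le by simp
    qed
    \<comment> \<open>The contribution of the values below \<open>2 \<delta>\<close> vanishes in the limit.\<close>
    have "I / 2 \<le> 4 powr q * C * I powr (2 / n) * B"
    proof (rule tendsto_lowerbound)
      show "((\<lambda>\<delta>. (2 * \<delta>) powr q * measure lborel K + 4 powr q * C * I powr (2 / n) * B)
          \<longlongrightarrow> 4 powr q * C * I powr (2 / n) * B) (at_right 0)"
      proof -
        have "((\<lambda>\<delta>. (2 * \<delta>) powr q) \<longlongrightarrow> 0) (at_right (0::real))"
        proof (rule tendsto_zero_powrI)
          show "((\<lambda>\<delta>. 2 * \<delta>) \<longlongrightarrow> 0) (at_right (0::real))" by (auto intro!: tendsto_eq_intros)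
          show "\<forall>\<^sub>F \<delta> in at_right (0::real). 0 \<le> 2 * \<delta>"
            by (rule eventually_mono[OF eventually_at_right_less[of 0]]) simp
        qed (use q1 in auto)
        from tendsto_add[OF tendsto_mult_right[OF this, of "measure lborel K"] tendsto_const]
        show ?thesis by simp
      qed
      show "\<forall>\<^sub>F \<delta> in at_right 0. I / 2 \<le> (2 * \<delta>) powr q * measure lborel K + 4 powr q * C * I powr (2 / n) * B"
        by (rule eventually_mono[OF eventually_at_right_less[of 0]]) (rule main)
    qed simp
    then have le: "I \<le> (2 * 4 powr q * C * B) * I powr (2 / n)" by (simp add: mult_ac)
    have "I powr ((n - 2) / n) \<le> 2 * 4 powr q * C * B"
    proof (cases "I = 0")
      case False
      then have Ip: "I > 0" using I0 by simp
      then have "I = I powr ((n - 2) / n) * I powr (2 / n)"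
        using n3 by (simp add: powr_add[symmetric] add_divide_distrib[symmetric])
      then have "I powr ((n - 2) / n) * I powr (2 / n) \<le> (2 * 4 powr q * C * B) * I powr (2 / n)"
        using le by simp
      then show ?thesis using Ip by simp
    qed (use C B0 in simp)
    then show "(\<integral>x. \<bar>u x\<bar> powr q \<partial>lborel) powr ((real DIM('a) - 2) / real DIM('a))
        \<le> 2 * 4 powr q * C * (\<integral>x. (norm (g x))\<^sup>2 \<partial>lborel)"
      by (simp add: I_def B_def n_def)
  qed
qed

section \<open>Logarithmic shells\<close>

text \<open>
  In the variable \<open>s = ln (R / |x|)\<close>: equal to 1 on \<open>[J, J + 1]\<close> and zero outside \<open>[J - 1, J + 2]\<close>.
\<close>

definition shell_cut :: "real \<Rightarrow> real \<Rightarrow> real" where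
  "shell_cut J s = smoothstep (s - J + 1) - smoothstep (s - J - 1)"

definition shell_cut' :: "real \<Rightarrow> real \<Rightarrow> real" where
  "shell_cut' J s = smoothstep' (s - J + 1) - smoothstep' (s - J - 1)"

definition shell_indicator :: "real \<Rightarrow> real \<Rightarrow> real" where
  "shell_indicator J s = (if \<bar>s - J\<bar> \<le> 2 then 1 else 0)"

lemma DERIV_shell_cut: "(shell_cut J has_real_derivative shell_cut' J s) (at s)"
proof -
  have "((\<lambda>s. smoothstep (s + c)) has_real_derivative smoothstep' (s + c)) (at s)" for c
  proof -
    have "((\<lambda>s. s + c) has_real_derivative 1) (at s)" by (auto intro!: derivative_eq_intros)
    from DERIV_chain2[where g="\<lambda>s. s + c", OF DERIV_smoothstep this] show ?thesis by simp
  qed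
  from DERIV_diff[OF this[of "1 - J"] this[of "- 1 - J"]]
  show ?thesis
    by (simp add: shell_cut_def[abs_def] shell_cut'_def algebra_simps)
qed

lemma continuous_shell_cut': "continuous_on S (shell_cut' J)"
  unfolding shell_cut'_def[abs_def]
  by (intro continuous_intros continuous_on_compose2[OF continuous_smoothstep'[of UNIV]]) auto

lemma shell_cut_one: "J \<le> s \<Longrightarrow> s \<le> J + 1 \<Longrightarrow> shell_cut J s = 1"
  by (simp add: shell_cut_def smoothstep_le)

lemma shell_cut_square: "(shell_cut J s)\<^sup>2 \<le> shell_indicator J s"
proof (cases "\<bar>s - J\<bar> \<le> 2")
  case True
  have "\<bar>shell_cut J s\<bar> \<le> 1"
    using smoothstep_bounds[of "s - J + 1"] smoothstep_bounds[of "s - J - 1"]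
    by (auto simp: shell_cut_def)
  then show ?thesis using True by (simp add: shell_indicator_def abs_square_le_1)
next
  case False
  then consider "s - J + 1 \<le> 0" "s - J - 1 \<le> 0" | "s - J + 1 \<ge> 1" "s - J - 1 \<ge> 1" by linarith
  then show ?thesis by cases (simp_all add: shell_cut_def smoothstep_le shell_indicator_def)
qed

lemma shell_cut'_square: "(shell_cut' J s)\<^sup>2 \<le> 4 * shell_indicator J s"
proof (cases "\<bar>s - J\<bar> \<le> 2")
  case True
  have "\<bar>shell_cut' J s\<bar> \<le> 2"
    using smoothstep'_bounds[of "s - J + 1"] smoothstep'_bounds[of "s - J - 1"]
    by (auto simp: shell_cut'_def)
  then have "\<bar>shell_cut' J s\<bar>\<^sup>2 \<le> 2\<^sup>2" by (intro power_mono) auto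
  then show ?thesis using True by (simp add: shell_indicator_def)
next
  case False
  then have "s - J + 1 \<le> 0 \<and> s - J - 1 \<le> 0 \<or> s - J + 1 \<ge> 1 \<and> s - J - 1 \<ge> 1" by linarith
  then have "shell_cut' J s = 0" by (auto simp: shell_cut'_def smoothstep'_zero)
  then show ?thesis by (simp add: shell_indicator_def)
qed

lemma shell_indicator_bounds: "0 \<le> shell_indicator J s" "shell_indicator J s \<le> 1"
  by (auto simp: shell_indicator_def)

lemma shell_indicator_measurable [measurable]: "shell_indicator J \<in> borel_measurable borel"
  unfolding shell_indicator_def[abs_def] by measurable

text \<open>
  At most five of the intervals \<open>|s - j| \<le> 2\<close> contain \<open>s\<close>, and \<open>1 + s \<le> 3 (1 + j)\<close> for each of them.
\<close>

lemma sum_shell_indicator_le: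
  assumes "s \<ge> 0"
  shows "(\<Sum>j<N. shell_indicator (real j) s / (1 + real j)\<^sup>2) \<le> 45 / (1 + s)\<^sup>2"
proof -
  define A where "A = {j. j < N \<and> \<bar>s - real j\<bar> \<le> 2}"
  have "card A \<le> 5"
  proof (cases "A = {}")
    case False
    define m where "m = (LEAST j. j \<in> A)"
    have m: "m \<in> A" unfolding m_def using False by (metis LeastI_ex ex_in_conv)
    have "A \<subseteq> {m..m + 4}"
    proof
      fix j assume j: "j \<in> A"
      then have "m \<le> j" unfolding m_def by (rule Least_le)
      moreover have "real j \<le> real m + 4" using j m by (auto simp: A_def)
      ultimately show "j \<in> {m..m + 4}" by auto
    qed
    then have "card A \<le> card {m..m + 4}" by (intro card_mono) auto
    then show ?thesis by simp
  qed simp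
  have "(\<Sum>j<N. shell_indicator (real j) s / (1 + real j)\<^sup>2) = (\<Sum>j\<in>A. shell_indicator (real j) s / (1 + real j)\<^sup>2)"
    by (rule sum.mono_neutral_right) (auto simp: A_def shell_indicator_def)
  also have "\<dots> \<le> (\<Sum>j\<in>A. 9 / (1 + s)\<^sup>2)"
  proof (rule sum_mono)
    fix j assume j: "j \<in> A"
    have "1 + s \<le> 3 * (1 + real j)"
      using j of_nat_0_le_iff[of j, where ?'a=real] unfolding A_def by (simp add: abs_le_iff)
    then have "(1 + s)\<^sup>2 \<le> (3 * (1 + real j))\<^sup>2"
      by (rule power_mono) (use assms in simp)
    then have "(1 + s)\<^sup>2 \<le> 9 * (1 + real j)\<^sup>2"
      by (simp only: power_mult_distrib) simp
    then have "1 / (1 + real j)\<^sup>2 \<le> 9 / (1 + s)\<^sup>2"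
      using assms by (simp add: divide_simps power_mult_distrib)
    moreover have "shell_indicator (real j) s / (1 + real j)\<^sup>2 \<le> 1 / (1 + real j)\<^sup>2"
      by (rule divide_right_mono) (auto simp: shell_indicator_bounds)
    ultimately show "shell_indicator (real j) s / (1 + real j)\<^sup>2 \<le> 9 / (1 + s)\<^sup>2" by linarith
  qed
  also have "\<dots> = real (card A) * (9 / (1 + s)\<^sup>2)" by simp
  also have "\<dots> \<le> 5 * (9 / (1 + s)\<^sup>2)"
    using \<open>card A \<le> 5\<close> by (intro mult_right_mono) auto
  finally show ?thesis by simp
qed

section \<open>Lower bounds for the Hardy deficit\<close>

context half_ball_fun
begin

text \<open>
  If \<open>u = \<phi> v\<close> with the ground state \<open>\<phi> = (x \<bullet> e) r powr (-n/2)\<close>, then this is \<open>\<phi> \<nabla>v\<close>.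
\<close>

definition "twisted_grad x = g x - u x *\<^sub>R hardy_field e R (\<lambda>_. 0) x"

lemma integrable_twisted_grad: "integrable lborel (\<lambda>x. (norm (twisted_grad x))\<^sup>2)"
  unfolding twisted_grad_def by (rule integrable_hardy) simp

lemma hardy_energy_twisted_grad: "hardy_energy = (\<integral>x. (norm (twisted_grad x))\<^sup>2 \<partial>lborel)"
  unfolding twisted_grad_def by (rule hardy_energy_ground)

lemma hardy_energy_nonneg: "hardy_energy \<ge> 0"
  by (simp add: hardy_energy_twisted_grad)

lemma integrable_hardy_weight: "integrable lborel (\<lambda>x. (u x)\<^sup>2 / (norm x)\<^sup>2)"
  using integrable_weight[of "\<lambda>_. 1"] by simp

text \<open>
  Here \<open>exp (-s/2) = (|x| / R) powr (1/2)\<close>. The weight in the theorem has the constant \<open>1/16\<close>, so half of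
  the deficit is left over for the \<open>L\<^sup>q\<close> term.
\<close>

lemma exp_weight_le:
  "(\<integral>x. exp (- lr x / 2) / 8 * ((u x)\<^sup>2 / (norm x)\<^sup>2) \<partial>lborel) \<le> hardy_energy"
  "integrable lborel (\<lambda>x. exp (- lr x / 2) / 8 * ((u x)\<^sup>2 / (norm x)\<^sup>2))"
proof -
  define f where "f s = 1 - exp (- s / 2) / 2" for s :: real
  define f' where "f' s = exp (- s / 2) / 4" for s :: real
  define f'' where "f'' s = - exp (- s / 2) / 8" for s :: real
  have pos: "f s > 0" if "s > 0" for s
  proof -
    have "exp (- s / 2) \<le> 1" using that by simp
    then show ?thesis unfolding f_def by linarith
  qed
  have V: "exp (- s / 2) / 8 * f s \<le> - f'' s" if "s > 0" for s
    by (simp add: f_def f''_def mult_left_le)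
  have d1: "(f has_real_derivative f' s) (at s)" for s
    unfolding f_def[abs_def] f'_def by (auto intro!: derivative_eq_intros)
  have d2: "(f' has_real_derivative f'' s) (at s)" for s
    unfolding f'_def[abs_def] f''_def by (auto intro!: derivative_eq_intros)
  have c: "continuous_on {0<..} f''"
    unfolding f''_def by (intro continuous_intros)  auto
  note * = hardy_energy_ge[of f f' f'' "\<lambda>s. exp (- s / 2) / 8", OF pos d1 d2 c V]
  show "(\<integral>x. exp (- lr x / 2) / 8 * ((u x)\<^sup>2 / (norm x)\<^sup>2) \<partial>lborel) \<le> hardy_energy"
    by (rule *(1)) auto
  show "integrable lborel (\<lambda>x. exp (- lr x / 2) / 8 * ((u x)\<^sup>2 / (norm x)\<^sup>2))"
    by (rule *(2)) auto
qed

text \<open>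
  The ground state factor \<open>sqrt (1 + s)\<close> satisfies \<open>- f'' = f / (4 (1 + s)\<^sup>2)\<close>.
\<close>

lemma log_weight_le:
  "(\<integral>x. 1 / (1 + lr x)\<^sup>2 * ((u x)\<^sup>2 / (norm x)\<^sup>2) \<partial>lborel) \<le> 4 * hardy_energy"
  "integrable lborel (\<lambda>x. 1 / (1 + lr x)\<^sup>2 * ((u x)\<^sup>2 / (norm x)\<^sup>2))"
proof -
  define f where "f s = sqrt (1 + s)" for s :: real
  define f' where "f' s = 1 / (2 * sqrt (1 + s))" for s :: real
  define f'' where "f'' s = - (1 / (4 * (1 + s) * sqrt (1 + s)))" for s :: real
  have pos: "f s > 0" if "s > 0" for s
    using that by (simp add: f_def)
  have d1: "(f has_real_derivative f' s) (at s)" if "s > 0" for s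
    unfolding f_def f'_def using that by (auto intro!: derivative_eq_intros simp: field_simps)
  have d2: "(f' has_real_derivative f'' s) (at s)" if "s > 0" for s
    unfolding f'_def f''_def using that
    by (auto intro!: derivative_eq_intros simp: field_simps)
  have c: "continuous_on {0<..} f''"
    unfolding f''_def by (intro continuous_intros) auto
  have V: "1 / (4 * (1 + s)\<^sup>2) * f s \<le> - f'' s" if "s > 0" for s
  proof -
    define q where "q = sqrt (1 + s)"
    have q: "q > 0" "1 + s = q * q" using that by (auto simp: q_def)
    show ?thesis
      unfolding f_def f''_def q_def[symmetric] unfolding q(2) using q(1)
      by (simp add: power2_eq_square)
  qed
  note * = hardy_energy_ge[of f f' f'' "\<lambda>s. 1 / (4 * (1 + s)\<^sup>2)", OF pos d1 d2 c V]
  have 1: "integrable lborel (\<lambda>x. 1 / (4 * (1 + lr x)\<^sup>2) * ((u x)\<^sup>2 / (norm x)\<^sup>2))"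
    by (rule *(2)) auto
  have eq: "1 / (1 + lr x)\<^sup>2 * ((u x)\<^sup>2 / (norm x)\<^sup>2) = 4 * (1 / (4 * (1 + lr x)\<^sup>2) * ((u x)\<^sup>2 / (norm x)\<^sup>2))" for x
    by simp
  show "integrable lborel (\<lambda>x. 1 / (1 + lr x)\<^sup>2 * ((u x)\<^sup>2 / (norm x)\<^sup>2))"
    unfolding eq using 1 by (rule integrable_mult_right)
  have "(\<integral>x. 1 / (4 * (1 + lr x)\<^sup>2) * ((u x)\<^sup>2 / (norm x)\<^sup>2) \<partial>lborel) \<le> hardy_energy"
    by (rule *(1)) auto
  then show "(\<integral>x. 1 / (1 + lr x)\<^sup>2 * ((u x)\<^sup>2 / (norm x)\<^sup>2) \<partial>lborel) \<le> 4 * hardy_energy"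
    unfolding eq by (subst integral_mult_right_zero) linarith
qed

text \<open>
  The concave function \<open>s + J + 2 - sqrt ((s - J)\<^sup>2 + 1)\<close> has slope about 2 before \<open>J\<close> and about 0
  after it. It bends on an interval of bounded length while its size there is of order \<open>J\<close>, so
  \<open>- f''/f\<close> is of order \<open>1 / J\<close> on the shell.
\<close>

lemma shell_weight_le:
  assumes J: "J \<ge> 0"
  shows "(\<integral>x. shell_indicator J (lr x) * ((u x)\<^sup>2 / (norm x)\<^sup>2) \<partial>lborel) \<le> 81 * (1 + J) * hardy_energy"
    "integrable lborel (\<lambda>x. shell_indicator J (lr x) * ((u x)\<^sup>2 / (norm x)\<^sup>2))"
proof -
  define r where "r s = sqrt ((s - J)\<^sup>2 + 1)" for s
  have sum_pos: "(s - J)\<^sup>2 + 1 > 0" for s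
    by (rule add_nonneg_pos) auto
  have r: "r s > 0" "r s * r s = (s - J)\<^sup>2 + 1" for s
    using sum_pos[of s] by (auto simp: r_def)
  have r1: "r s \<ge> 1" for s unfolding r_def by (rule real_le_rsqrt) simp
  have r2: "r s \<le> \<bar>s - J\<bar> + 1" for s
    unfolding r_def by (rule real_le_lsqrt) (auto simp: power2_eq_square algebra_simps)
  have dr: "(r has_real_derivative (s - J) / r s) (at s)" for s
    unfolding r_def[abs_def] using sum_pos[of s] r(1)[of s]
    by (auto intro!: derivative_eq_intros simp: field_simps)
  define f where "f s = s + J + 2 - r s" for s
  define f' where "f' s = 1 - (s - J) / r s" for s
  define f'' where "f'' s = - 1 / (r s * r s * r s)" for s
  have pos: "f s > 0" if "s > 0" for s
    using r2[of s] that J by (auto simp: f_def)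
  have d1: "(f has_real_derivative f' s) (at s)" for s
    unfolding f_def[abs_def] f'_def by (auto intro!: derivative_eq_intros dr)
  have d2: "(f' has_real_derivative f'' s) (at s)" for s
  proof -
    have "(f' has_real_derivative - ((r s - (s - J) * ((s - J) / r s)) / (r s * r s))) (at s)"
      unfolding f'_def[abs_def] using r(1)[of s]
      by (auto intro!: derivative_eq_intros dr)
    moreover have "r s - (s - J) * ((s - J) / r s) = 1 / r s"
      using r(1)[of s] r(2)[of s] by (simp add: field_simps power2_eq_square)
    ultimately show ?thesis by (simp add: f''_def mult_ac)
  qed
  have c: "continuous_on {0<..} f''"
    unfolding f''_def r_def using sum_pos by (intro continuous_intros) (auto simp: less_imp_neq[symmetric])
  have V: "shell_indicator J s / (81 * (1 + J)) * f s \<le> - f'' s" if s: "s > 0" for s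
  proof (cases "\<bar>s - J\<bar> \<le> 2")
    case True
    have "r s \<le> 3" using r2[of s] True by simp
    then have "r s * r s * r s \<le> 3 * 3 * 3"
      using r(1)[of s] by (intro mult_mono) auto
    then have "1 / 27 \<le> - f'' s"
      using r(1)[of s] by (simp add: f''_def divide_simps)
    moreover have "f s \<le> 3 * (1 + J)"
      using r1[of s] True J by (auto simp: f_def)
    then have "1 / (81 * (1 + J)) * f s \<le> 1 / 27"
      using J by (simp add: field_simps)
    ultimately have "1 / (81 * (1 + J)) * f s \<le> - f'' s" by linarith
    then show ?thesis using True by (simp add: shell_indicator_def)
  next
    case False
    then show ?thesis using r(1)[of s] by (simp add: shell_indicator_def f''_def)
  qed
  note * = hardy_energy_ge[of f f' f'' "\<lambda>s. shell_indicator J s / (81 * (1 + J))", OF pos d1 d2 c V]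
  have eq: "shell_indicator J (lr x) * ((u x)\<^sup>2 / (norm x)\<^sup>2)
      = (81 * (1 + J)) * (shell_indicator J (lr x) / (81 * (1 + J)) * ((u x)\<^sup>2 / (norm x)\<^sup>2))" for x
    using J by simp
  have 1: "integrable lborel (\<lambda>x. shell_indicator J (lr x) / (81 * (1 + J)) * ((u x)\<^sup>2 / (norm x)\<^sup>2))"
    by (rule *(2)) (use J in \<open>auto simp: shell_indicator_bounds\<close>)
  show "integrable lborel (\<lambda>x. shell_indicator J (lr x) * ((u x)\<^sup>2 / (norm x)\<^sup>2))"
    unfolding eq using 1 by (rule integrable_mult_right)
  have "(\<integral>x. shell_indicator J (lr x) / (81 * (1 + J)) * ((u x)\<^sup>2 / (norm x)\<^sup>2) \<partial>lborel) \<le> hardy_energy"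
    by (rule *(1)) (use J in \<open>auto simp: shell_indicator_bounds\<close>)
  then show "(\<integral>x. shell_indicator J (lr x) * ((u x)\<^sup>2 / (norm x)\<^sup>2) \<partial>lborel) \<le> 81 * (1 + J) * hardy_energy"
    unfolding eq using J by (subst integral_mult_right_zero) (rule mult_left_mono, auto)
qed

end

section \<open>Localisation and the logarithmic Sobolev inequality\<close>

context half_ball_fun
begin

definition "shell_energy J = (\<integral>x. shell_indicator J (lr x) * ((norm (twisted_grad x))\<^sup>2 + (u x)\<^sup>2 / (norm x)\<^sup>2) \<partial>lborel)"

lemma lr_measurable [measurable]: "lr \<in> borel_measurable borel"
  unfolding lr_def by measurable

lemma integrable_shell_indicator:
  fixes f :: "'a \<Rightarrow> real"
  assumes "integrable lborel f"
  shows "integrable lborel (\<lambda>x. shell_indicator J (lr x) * f x)"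
  by (rule Bochner_Integration.integrable_bound[OF assms])
    (use assms in \<open>auto simp: abs_mult shell_indicator_bounds mult_left_le_one_le\<close>)

lemma shell_energy_le:
  assumes J: "J \<ge> 0"
  shows "shell_energy J \<le> 82 * (1 + J) * hardy_energy"
proof -
  have "shell_energy J = (\<integral>x. shell_indicator J (lr x) * (norm (twisted_grad x))\<^sup>2 \<partial>lborel) + (\<integral>x. shell_indicator J (lr x) * ((u x)\<^sup>2 / (norm x)\<^sup>2) \<partial>lborel)"
    unfolding shell_energy_def distrib_left
    by (rule Bochner_Integration.integral_add[OF integrable_shell_indicator[OF integrable_twisted_grad] shell_weight_le(2)[OF J]])
  also have "\<dots> \<le> hardy_energy + 81 * (1 + J) * hardy_energy"
  proof (rule add_mono[OF _ shell_weight_le(1)[OF J]])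
    show "(\<integral>x. shell_indicator J (lr x) * (norm (twisted_grad x))\<^sup>2 \<partial>lborel) \<le> hardy_energy"
      unfolding hardy_energy_twisted_grad
      by (rule integral_mono[OF integrable_shell_indicator[OF integrable_twisted_grad] integrable_twisted_grad])
        (simp add: mult_left_le_one_le shell_indicator_bounds)
  qed
  also have "\<dots> \<le> 82 * (1 + J) * hardy_energy"
    using J hardy_energy_nonneg by (simp add: algebra_simps)
  finally show ?thesis .
qed

lemma shell_energy_nonneg: "shell_energy J \<ge> 0"
  unfolding shell_energy_def by (intro integral_nonneg_AE AE_I2) (simp add: shell_indicator_bounds)

lemma sum_shell_energy_le:
  "(\<Sum>j<N. shell_energy (real j) / (1 + real j)\<^sup>2) \<le> 225 * hardy_energy"
proof -
  have i: "integrable lborel (\<lambda>x. (norm (twisted_grad x))\<^sup>2 + (u x)\<^sup>2 / (norm x)\<^sup>2)"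
    using integrable_twisted_grad integrable_hardy_weight by simp
  have i2: "integrable lborel (\<lambda>x. shell_indicator (real j) (lr x) * ((norm (twisted_grad x))\<^sup>2 + (u x)\<^sup>2 / (norm x)\<^sup>2) / (1 + real j)\<^sup>2)" for j
    using integrable_shell_indicator[OF i] by (rule integrable_divide_zero)
  have "(\<Sum>j<N. shell_energy (real j) / (1 + real j)\<^sup>2)
    = (\<integral>x. (\<Sum>j<N. shell_indicator (real j) (lr x) * ((norm (twisted_grad x))\<^sup>2 + (u x)\<^sup>2 / (norm x)\<^sup>2) / (1 + real j)\<^sup>2) \<partial>lborel)"
    unfolding shell_energy_def using i2 by (subst Bochner_Integration.integral_sum) auto
  also have "\<dots> \<le> (\<integral>x. 45 * ((norm (twisted_grad x))\<^sup>2 + 1 / (1 + lr x)\<^sup>2 * ((u x)\<^sup>2 / (norm x)\<^sup>2)) \<partial>lborel)"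
  proof (rule integral_mono)
    show "integrable lborel (\<lambda>x. \<Sum>j<N. shell_indicator (real j) (lr x) * ((norm (twisted_grad x))\<^sup>2 + (u x)\<^sup>2 / (norm x)\<^sup>2) / (1 + real j)\<^sup>2)"
      using i2 by (rule Bochner_Integration.integrable_sum)
    show "integrable lborel (\<lambda>x. 45 * ((norm (twisted_grad x))\<^sup>2 + 1 / (1 + lr x)\<^sup>2 * ((u x)\<^sup>2 / (norm x)\<^sup>2)))"
      using integrable_twisted_grad log_weight_le(2) by (intro integrable_mult_right Bochner_Integration.integrable_add)
    fix x
    show "(\<Sum>j<N. shell_indicator (real j) (lr x) * ((norm (twisted_grad x))\<^sup>2 + (u x)\<^sup>2 / (norm x)\<^sup>2) / (1 + real j)\<^sup>2)
      \<le> 45 * ((norm (twisted_grad x))\<^sup>2 + 1 / (1 + lr x)\<^sup>2 * ((u x)\<^sup>2 / (norm x)\<^sup>2))"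
    proof (cases "x \<in> K")
      case True
      note s = lr_pos[OF True]
      define z where "z = 1 / (1 + lr x)\<^sup>2"
      have z: "z \<le> 1" using s by (simp add: z_def divide_simps)
      have "(\<Sum>j<N. shell_indicator (real j) (lr x) * ((norm (twisted_grad x))\<^sup>2 + (u x)\<^sup>2 / (norm x)\<^sup>2) / (1 + real j)\<^sup>2)
        = (\<Sum>j<N. shell_indicator (real j) (lr x) / (1 + real j)\<^sup>2) * ((norm (twisted_grad x))\<^sup>2 + (u x)\<^sup>2 / (norm x)\<^sup>2)"
        by (simp add: sum_distrib_right)
      also have "\<dots> \<le> (45 * z) * ((norm (twisted_grad x))\<^sup>2 + (u x)\<^sup>2 / (norm x)\<^sup>2)"
        using sum_shell_indicator_le[of "lr x" N] s by (intro mult_right_mono) (auto simp: z_def)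
      also have "\<dots> = 45 * (z * (norm (twisted_grad x))\<^sup>2 + z * ((u x)\<^sup>2 / (norm x)\<^sup>2))"
        by (simp add: algebra_simps)
      also have "\<dots> \<le> 45 * ((norm (twisted_grad x))\<^sup>2 + z * ((u x)\<^sup>2 / (norm x)\<^sup>2))"
        using mult_right_mono[OF z, of "(norm (twisted_grad x))\<^sup>2"] by simp
      finally show ?thesis by (simp add: z_def)
    next
      case False
      then show ?thesis
        by (simp add: twisted_grad_def C1_supp_zero[OF u] C1_supp_grad_zero[OF u])
    qed
  qed
  also have "\<dots> = 45 * (hardy_energy + (\<integral>x. 1 / (1 + lr x)\<^sup>2 * ((u x)\<^sup>2 / (norm x)\<^sup>2) \<partial>lborel))"
    unfolding hardy_energy_twisted_grad using integrable_twisted_grad log_weight_le(2)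
    by (subst integral_mult_right_zero, subst Bochner_Integration.integral_add) auto
  also have "\<dots> \<le> 225 * hardy_energy"
    using log_weight_le(1) by simp
  finally show ?thesis .
qed

definition "shell_u J x = shell_cut J (lr x) * u x"
definition "shell_g J x = shell_cut J (lr x) *\<^sub>R g x
    + u x *\<^sub>R ((- shell_cut' J (lr x) / (norm x)\<^sup>2) *\<^sub>R x)"

lemma C1_supp_shell: "C1_supp K (shell_u J) (shell_g J)"
proof -
  let ?U = "{x. x \<bullet> e > 0 \<and> norm x < R}"
  have U0: "x \<in> ?U \<Longrightarrow> norm x > 0" for x by auto
  show ?thesis
    unfolding shell_u_def shell_g_def
  proof (rule C1_supp_mult[OF u open_half_ball K])
    fix x assume x: "x \<in> ?U"
    have "((\<lambda>r. ln (R / r)) has_real_derivative - 1 / norm x) (at (norm x))"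
      using U0[OF x] R by (auto intro!: derivative_eq_intros simp: field_simps power2_eq_square)
    from DERIV_chain2[where g="\<lambda>r. ln (R / r)", OF DERIV_shell_cut this]
    have "((\<lambda>r. shell_cut J (ln (R / r))) has_real_derivative shell_cut' J (lr x) * (- 1 / norm x)) (at (norm x))"
      by (simp add: lr_def)
    from GDERIV_fun_norm[OF _ this] U0[OF x]
    show "GDERIV (\<lambda>x. shell_cut J (lr x)) x :> (- shell_cut' J (lr x) / (norm x)\<^sup>2) *\<^sub>R x"
      by (simp add: lr_def power2_eq_square)
  next
    have "continuous_on ?U lr"
      unfolding lr_def using U0 R by (intro continuous_intros) fastforce+
    then have "continuous_on ?U (\<lambda>x. shell_cut' J (lr x))"
      by (intro continuous_on_compose2[OF continuous_shell_cut'[of UNIV]]) auto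
    then show "continuous_on ?U (\<lambda>x. (- shell_cut' J (lr x) / (norm x)\<^sup>2) *\<^sub>R x)"
      by (intro continuous_intros) auto
  qed
qed

text \<open>
  The ground state identity is applied to the cut-off function itself. Its twisted gradient is the
  cutoff times that of \<open>u\<close> plus \<open>u\<close> times the gradient of the cutoff, which is of order \<open>1 / |x|\<close>; the
  gradient of \<open>u\<close> alone would not be controlled near the flat boundary.
\<close>

lemma shell_gradient_le:
  "(\<integral>x. (norm (shell_g J x))\<^sup>2 \<partial>lborel) \<le> (8 + (real DIM('a))\<^sup>2 / 4) * shell_energy J"
proof -
  interpret v: half_ball_fun K e R "shell_u J" "shell_g J"
    by unfold_locales (use C1_supp_shell e R K in auto)
  have i: "integrable lborel (\<lambda>x. (norm (twisted_grad x))\<^sup>2 + (u x)\<^sup>2 / (norm x)\<^sup>2)"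
    using integrable_twisted_grad integrable_hardy_weight by simp
  have pw: "(norm (v.twisted_grad x))\<^sup>2 \<le> 8 * (shell_indicator J (lr x) * ((norm (twisted_grad x))\<^sup>2 + (u x)\<^sup>2 / (norm x)\<^sup>2))" for x
  proof -
    have "v.twisted_grad x = shell_cut J (lr x) *\<^sub>R twisted_grad x + (- (u x * shell_cut' J (lr x)) / (norm x)\<^sup>2) *\<^sub>R x"
      by (simp add: v.twisted_grad_def twisted_grad_def shell_u_def shell_g_def algebra_simps)
    moreover have "norm ((- (u x * shell_cut' J (lr x)) / (norm x)\<^sup>2) *\<^sub>R x) = \<bar>u x\<bar> * \<bar>shell_cut' J (lr x)\<bar> / norm x"
      by (simp add: abs_mult power2_eq_square)
    ultimately have "norm (v.twisted_grad x) \<le> \<bar>shell_cut J (lr x)\<bar> * norm (twisted_grad x) + \<bar>u x\<bar> * \<bar>shell_cut' J (lr x)\<bar> / norm x"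
      by (metis norm_scaleR norm_triangle_ineq)
    then have "(norm (v.twisted_grad x))\<^sup>2 \<le> (\<bar>shell_cut J (lr x)\<bar> * norm (twisted_grad x) + \<bar>u x\<bar> * \<bar>shell_cut' J (lr x)\<bar> / norm x)\<^sup>2"
      by (intro power_mono) auto
    also have "\<dots> \<le> 2 * ((shell_cut J (lr x))\<^sup>2 * (norm (twisted_grad x))\<^sup>2) + 2 * ((shell_cut' J (lr x))\<^sup>2 * ((u x)\<^sup>2 / (norm x)\<^sup>2))"
    proof -
      have "(a + b)\<^sup>2 \<le> 2 * a\<^sup>2 + 2 * b\<^sup>2" for a b :: real
        using zero_le_power2[of "a - b"] by (simp add: power2_eq_square algebra_simps)
      from this[of "\<bar>shell_cut J (lr x)\<bar> * norm (twisted_grad x)" "\<bar>u x\<bar> * \<bar>shell_cut' J (lr x)\<bar> / norm x"]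
      show ?thesis by (simp add: power_mult_distrib power_divide mult_ac)
    qed
    also have "\<dots> \<le> 2 * (shell_indicator J (lr x) * (norm (twisted_grad x))\<^sup>2) + 2 * (4 * shell_indicator J (lr x) * ((u x)\<^sup>2 / (norm x)\<^sup>2))"
      by (intro add_mono mult_left_mono mult_right_mono shell_cut_square shell_cut'_square) auto
    also have "\<dots> \<le> 8 * (shell_indicator J (lr x) * ((norm (twisted_grad x))\<^sup>2 + (u x)\<^sup>2 / (norm x)\<^sup>2))"
      using shell_indicator_bounds(1)[of J "lr x"] by (simp add: algebra_simps)
    finally show ?thesis .
  qed
  have "v.hardy_energy \<le> (\<integral>x. 8 * (shell_indicator J (lr x) * ((norm (twisted_grad x))\<^sup>2 + (u x)\<^sup>2 / (norm x)\<^sup>2)) \<partial>lborel)"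
    unfolding v.hardy_energy_twisted_grad
    by (rule integral_mono[OF v.integrable_twisted_grad _ pw]) (intro integrable_mult_right integrable_shell_indicator i)
  then have 1: "v.hardy_energy \<le> 8 * shell_energy J" by (simp add: shell_energy_def)
  have 2: "(\<integral>x. (shell_u J x)\<^sup>2 / (norm x)\<^sup>2 \<partial>lborel) \<le> shell_energy J"
    unfolding shell_energy_def
  proof (rule integral_mono[OF v.integrable_hardy_weight integrable_shell_indicator[OF i]])
    fix x
    have "(shell_u J x)\<^sup>2 / (norm x)\<^sup>2 = (shell_cut J (lr x))\<^sup>2 * ((u x)\<^sup>2 / (norm x)\<^sup>2)"
      by (simp add: shell_u_def power_mult_distrib)
    also have "\<dots> \<le> shell_indicator J (lr x) * ((u x)\<^sup>2 / (norm x)\<^sup>2)"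
      by (intro mult_right_mono shell_cut_square) simp
    also have "\<dots> \<le> shell_indicator J (lr x) * ((norm (twisted_grad x))\<^sup>2 + (u x)\<^sup>2 / (norm x)\<^sup>2)"
      by (intro mult_left_mono) (auto simp: shell_indicator_bounds)
    finally show "(shell_u J x)\<^sup>2 / (norm x)\<^sup>2 \<le> shell_indicator J (lr x) * ((norm (twisted_grad x))\<^sup>2 + (u x)\<^sup>2 / (norm x)\<^sup>2)" .
  qed
  have "(\<integral>x. (norm (shell_g J x))\<^sup>2 \<partial>lborel) = v.hardy_energy + (real DIM('a))\<^sup>2 / 4 * (\<integral>x. (shell_u J x)\<^sup>2 / (norm x)\<^sup>2 \<partial>lborel)"
    by (simp add: v.hardy_energy_def)
  also have "\<dots> \<le> 8 * shell_energy J + (real DIM('a))\<^sup>2 / 4 * shell_energy J"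
    by (intro add_mono 1 mult_left_mono 2) simp
  finally show ?thesis by (simp add: algebra_simps)
qed

text \<open>
  The Sobolev inequality is applied on each shell. With \<open>T\<close> the shell energy and \<open>d = 1 + j\<close>, the
  contribution \<open>d powr (- 1 - p) * T powr p\<close> splits into \<open>T / d\<^sup>2\<close>, which is summable, and
  \<open>(T / d) powr (p - 1)\<close>, which is bounded uniformly in \<open>j\<close>.
\<close>

lemma log_sobolev:
  fixes n :: real
  assumes n: "n = real DIM('a)" "n \<ge> 3" and S: "S > 0"
    and sob: "\<And>v w. C1_supp K v w \<Longrightarrow>
      (\<integral>x. \<bar>v x\<bar> powr (2 * n / (n - 2)) \<partial>lborel) powr ((n - 2) / n) \<le> S * (\<integral>x. (norm (w x))\<^sup>2 \<partial>lborel)"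
  shows "(\<integral>x. (1 / (1 + lr x)) powr ((2 * n - 2) / (n - 2)) * \<bar>u x\<bar> powr (2 * n / (n - 2)) \<partial>lborel)
      powr ((n - 2) / n) \<le> 225 * (S * (8 + n\<^sup>2 / 4)) * hardy_energy"
proof -
  define q where "q = 2 * n / (n - 2)"
  define p where "p = n / (n - 2)"
  define c where "c = S * (8 + n\<^sup>2 / 4)"
  define H where "H = hardy_energy"
  have q0: "q > 0" and p1: "p > 1" using n by (simp_all add: q_def p_def field_simps)
  have ip: "(n - 2) / n = 1 / p" by (simp add: p_def)
  have a: "(2 * n - 2) / (n - 2) = 1 + p" using n by (simp add: p_def field_simps)
  have "8 + n\<^sup>2 / 4 > 0" by (simp add: add_pos_nonneg)
  then have c: "c > 0" using S by (simp add: c_def)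
  have H: "H \<ge> 0" by (simp add: H_def hardy_energy_nonneg)
  have P: "(\<integral>x. \<bar>shell_u J x\<bar> powr q \<partial>lborel) \<le> (c * shell_energy J) powr p" for J
  proof -
    let ?P = "\<integral>x. \<bar>shell_u J x\<bar> powr q \<partial>lborel"
    have "?P powr (1 / p) \<le> S * (\<integral>x. (norm (shell_g J x))\<^sup>2 \<partial>lborel)"
      using sob[OF C1_supp_shell] by (simp add: q_def ip)
    also have "\<dots> \<le> S * ((8 + n\<^sup>2 / 4) * shell_energy J)"
      using S shell_gradient_le[of J] unfolding n by (intro mult_left_mono) auto
    also have "\<dots> = c * shell_energy J" by (simp add: c_def)
    finally have "(?P powr (1 / p)) powr p \<le> (c * shell_energy J) powr p"
      using p1 by (intro powr_mono2) auto
    then show ?thesis using p1 by (simp add: powr_powr)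
  qed
  have shell_i: "integrable lborel (\<lambda>x. \<bar>shell_u J x\<bar> powr q)" for J
    by (rule C1_supp_integrable_powr[OF C1_supp_shell q0])
  have "bounded (lr ` K)"
    by (meson u C1_supp_compact cont_lr compact_continuous_image compact_imp_bounded)
  then obtain M where "\<forall>x\<in>K. \<bar>lr x\<bar> \<le> M" by (auto simp: bounded_iff)
  moreover obtain N :: nat where "M < real N" using reals_Archimedean2 by blast
  ultimately have N: "lr x < real N" if "x \<in> K" for x using that by force
  define Q where "Q = (\<integral>x. (1 / (1 + lr x)) powr (1 + p) * \<bar>u x\<bar> powr q \<partial>lborel)"
  have Q0: "Q \<ge> 0" unfolding Q_def by (intro integral_nonneg_AE AE_I2) simp
  have "Q \<le> (\<integral>x. (\<Sum>j<N. (1 / (1 + real j)) powr (1 + p) * \<bar>shell_u (real j) x\<bar> powr q) \<partial>lborel)"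
    unfolding Q_def
  proof (rule integral_mono)
    show "integrable lborel (\<lambda>x. (1 / (1 + lr x)) powr (1 + p) * \<bar>u x\<bar> powr q)"
    proof (rule integrable_supp[OF u])
      have nz: "x \<in> K \<Longrightarrow> 1 + lr x \<noteq> 0" for x using lr_pos[of x] by auto
      have "continuous_on K (\<lambda>x. \<bar>u x\<bar> powr q)"
        by (rule continuous_on_powr') (use q0 in \<open>auto intro!: continuous_intros C1_supp_cont[OF u]\<close>)
      then show "continuous_on K (\<lambda>x. (1 / (1 + lr x)) powr (1 + p) * \<bar>u x\<bar> powr q)"
        by (rule continuous_on_mult[rotated]) (use nz in \<open>auto intro!: continuous_intros cont_lr\<close>)
    qed (simp add: C1_supp_zero[OF u])
    show "integrable lborel (\<lambda>x. \<Sum>j<N. (1 / (1 + real j)) powr (1 + p) * \<bar>shell_u (real j) x\<bar> powr q)"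
      by (intro Bochner_Integration.integrable_sum integrable_mult_right shell_i)
    fix x
    show "(1 / (1 + lr x)) powr (1 + p) * \<bar>u x\<bar> powr q
      \<le> (\<Sum>j<N. (1 / (1 + real j)) powr (1 + p) * \<bar>shell_u (real j) x\<bar> powr q)"
    proof (cases "x \<in> K")
      case True
      note s = lr_pos[OF True]
      \<comment> \<open>The shell that contains \<open>x\<close>: the cutoff equals 1 there and \<open>1 / (1 + s) \<le> 1 / (1 + j)\<close>.\<close>
      define j where "j = nat \<lfloor>lr x\<rfloor>"
      have j: "real j \<le> lr x" "lr x \<le> real j + 1" "j < N"
        using s N[OF True] unfolding j_def by linarith+
      have "(1 / (1 + lr x)) powr (1 + p) * \<bar>u x\<bar> powr q
          \<le> (1 / (1 + real j)) powr (1 + p) * \<bar>shell_u (real j) x\<bar> powr q"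
        using j s p1 by (auto simp: shell_u_def shell_cut_one intro!: mult_right_mono powr_mono2 divide_left_mono)
      also have "\<dots> \<le> (\<Sum>j<N. (1 / (1 + real j)) powr (1 + p) * \<bar>shell_u (real j) x\<bar> powr q)"
        using j(3) by (intro member_le_sum) auto
      finally show ?thesis .
    next
      case False
      then show ?thesis by (simp add: C1_supp_zero[OF u] sum_nonneg)
    qed
  qed
  also have "\<dots> = (\<Sum>j<N. (1 / (1 + real j)) powr (1 + p) * (\<integral>x. \<bar>shell_u (real j) x\<bar> powr q \<partial>lborel))"
    using shell_i by simp
  also have "\<dots> \<le> (\<Sum>j<N. c powr p * (82 * H) powr (p - 1) * (shell_energy (real j) / (1 + real j)\<^sup>2))"
  proof (rule sum_mono)
    fix j
    define d where "d = 1 + real j"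
    define t where "t = shell_energy (real j)"
    have d: "d > 0" by (simp add: d_def)
    have t: "t \<ge> 0" "t / d \<le> 82 * H"
      using shell_energy_nonneg shell_energy_le[of "real j"] d
      by (simp_all add: t_def d_def H_def pos_divide_le_eq mult_ac)
    have "(1 / d) powr (1 + p) * (\<integral>x. \<bar>shell_u (real j) x\<bar> powr q \<partial>lborel) \<le> (1 / d) powr (1 + p) * (c * t) powr p"
      unfolding t_def by (intro mult_left_mono P) simp
    also have "\<dots> = c powr p * (1 / d * (t / d) powr p)"
    proof -
      have "(1 / d) powr (1 + p) = 1 / d * (1 / d) powr p"
        using d powr_mult_base[of "1 / d" p] by simp
      moreover have "(t / d) powr p = (1 / d) powr p * t powr p"
        using d t by (simp add: powr_mult[symmetric])
      moreover have "(c * t) powr p = c powr p * t powr p"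
        using c t by (simp add: powr_mult)
      ultimately show ?thesis by simp
    qed
    also have "(t / d) powr p = t / d * (t / d) powr (p - 1)"
      using d t powr_mult_base[of "t / d" "p - 1"] by simp
    also have "c powr p * (1 / d * (t / d * (t / d) powr (p - 1))) \<le> c powr p * (1 / d * (t / d * (82 * H) powr (p - 1)))"
      using d t p1 by (intro mult_left_mono powr_mono2) auto
    also have "\<dots> = c powr p * (82 * H) powr (p - 1) * (t / d\<^sup>2)"
      by (simp add: power2_eq_square)
    finally show "(1 / (1 + real j)) powr (1 + p) * (\<integral>x. \<bar>shell_u (real j) x\<bar> powr q \<partial>lborel)
      \<le> c powr p * (82 * H) powr (p - 1) * (shell_energy (real j) / (1 + real j)\<^sup>2)"
      by (simp add: d_def t_def)
  qed
  also have "\<dots> = c powr p * (82 * H) powr (p - 1) * (\<Sum>j<N. shell_energy (real j) / (1 + real j)\<^sup>2)"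
    by (simp add: sum_distrib_left)
  also have "\<dots> \<le> c powr p * (225 * H) powr (p - 1) * (225 * H)"
    using H p1 c sum_shell_energy_le[of N] unfolding H_def
    by (intro mult_mono mult_nonneg_nonneg powr_mono2 sum_nonneg) (auto intro!: divide_nonneg_nonneg shell_energy_nonneg)
  also have "\<dots> = c powr p * (225 * H) powr p"
    using H powr_mult_base[of "225 * H" "p - 1"] by (simp add: mult_ac)
  also have "\<dots> = (225 * c * H) powr p"
    using c H by (simp add: powr_mult[symmetric] mult_ac)
  finally have "Q powr (1 / p) \<le> ((225 * c * H) powr p) powr (1 / p)"
    using Q0 p1 by (intro powr_mono2) auto
  also have "\<dots> = 225 * c * H"
    using c H p1 by (simp add: powr_powr)
  finally show ?thesis
    unfolding a ip by (simp add: Q_def q_def c_def H_def)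
qed

end

section \<open>The Hardy-Sobolev inequality with remainder\<close>

text \<open>
  The gradient is continuous because the partial derivatives are themselves differentiable.
\<close>

lemma smooth_C1_supp:
  fixes u :: "real ^ 'n \<Rightarrow> real"
  assumes "u \<in> test_functions \<Omega>"
  shows "C1_supp (closure {x. u x \<noteq> 0}) u (grad u)"
proof -
  have "C_diff (Suc (Suc 0)) u"
    using assms by (simp add: test_functions_def smooth_def del: C_diff.simps)
  then have d: "u differentiable (at x)" "partial_deriv i u differentiable (at x)" for x i
    by simp_all
  have "continuous_on UNIV (partial_deriv i u)" for i
    by (rule continuous_at_imp_continuous_on) (use d(2) differentiable_imp_continuous_within in blast)
  then have "continuous_on UNIV (grad u)"
    unfolding grad_def[abs_def] by (rule continuous_on_vec_lambda)
  moreover have "u x = 0" if "x \<notin> closure {x. u x \<noteq> 0}" for x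
    using closure_subset[of "{x. u x \<noteq> 0}"] that by auto
  moreover have "compact (closure {x. u x \<noteq> 0})"
    using assms by (simp add: test_functions_def)
  ultimately show ?thesis
    unfolding C1_supp_def by (intro conjI allI impI GDERIV_grad d(1))
qed

lemma set_integral_supp:
  fixes f :: "'a::euclidean_space \<Rightarrow> real"
  assumes "K \<subseteq> A" "\<And>x. x \<notin> K \<Longrightarrow> f x = 0"
  shows "(LINT x:A|lborel. f x) = (\<integral>x. f x \<partial>lborel)"
  unfolding set_lebesgue_integral_def
  by (rule Bochner_Integration.integral_cong) (use assms in \<open>auto simp: indicator_def\<close>)

context half_ball_fun
begin

lemma remainder_weight_eq:
  assumes "x \<in> K"
  shows "(u x)\<^sup>2 / norm x powr (3/2) = R powr (1/2) * (exp (- lr x / 2) * ((u x)\<^sup>2 / (norm x)\<^sup>2))"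
proof -
  note x = K_nz(1)[OF assms]
  have "- lr x / 2 = ln (norm x) / 2 - ln R / 2"
    using x R by (simp add: lr_def ln_div field_simps)
  then have "exp (- lr x / 2) = norm x powr (1/2) / R powr (1/2)"
    using x R by (simp only: exp_diff) (simp add: powr_def)
  moreover have "(norm x)\<^sup>2 = norm x powr (3/2) * norm x powr (1/2)"
    using x by (simp add: powr_add[symmetric])
  ultimately show ?thesis
    using x R by simp
qed

lemma remainder_le:
  "1 / (16 * R powr (1/2)) * (\<integral>x. (u x)\<^sup>2 / norm x powr (3/2) \<partial>lborel) \<le> hardy_energy / 2"
proof -
  have "(u x)\<^sup>2 / norm x powr (3/2) = (8 * R powr (1/2)) * (exp (- lr x / 2) / 8 * ((u x)\<^sup>2 / (norm x)\<^sup>2))" for x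
    by (cases "x \<in> K") (simp_all add: remainder_weight_eq C1_supp_zero[OF u])
  then have "(\<integral>x. (u x)\<^sup>2 / norm x powr (3/2) \<partial>lborel)
      = (8 * R powr (1/2)) * (\<integral>x. exp (- lr x / 2) / 8 * ((u x)\<^sup>2 / (norm x)\<^sup>2) \<partial>lborel)"
    by (simp only: integral_mult_right_zero)
  then have "1 / (16 * R powr (1/2)) * (\<integral>x. (u x)\<^sup>2 / norm x powr (3/2) \<partial>lborel)
      = 1 / 2 * (\<integral>x. exp (- lr x / 2) / 8 * ((u x)\<^sup>2 / (norm x)\<^sup>2) \<partial>lborel)"
    using R by simp
  then show ?thesis using exp_weight_le(1) by simp
qed

lemma X1_lr: "x \<in> K \<Longrightarrow> X1 (norm x / R) = 1 / (1 + lr x)"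
  using K_nz[of x] R by (simp add: X1_def lr_def ln_div)

end

theorem lemma2:
  fixes n :: nat
  assumes "n = CARD('n::finite)" and "n \<ge> 3"
  shows "\<exists>C>0. \<forall>(k::'n) R u. R > 0 \<longrightarrow> u \<in> test_functions (half_ball k R) \<longrightarrow>
    (LINT x:half_ball k R|lborel. (norm (grad u x))\<^sup>2) \<ge>
      (real n)\<^sup>2 / 4 * (LINT x:half_ball k R|lborel. (u x)\<^sup>2 / (norm x)\<^sup>2)
      + 1 / (16 * R powr (1/2)) * (LINT x:half_ball k R|lborel. (u x)\<^sup>2 / norm x powr (3/2))
      + C * (LINT x:half_ball k R|lborel.
               X1 (norm x / R) powr ((2 * real n - 2) / (real n - 2))
               * \<bar>u x\<bar> powr (2 * real n / (real n - 2)))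
            powr ((real n - 2) / real n)"
proof -
  have dim: "DIM(real ^ 'n) = n" using assms by simp
  obtain S where S: "S > 0" and sob: "\<And>K (u :: real ^ 'n \<Rightarrow> real) g. C1_supp K u g \<Longrightarrow>
    (\<integral>x. \<bar>u x\<bar> powr (2 * real n / (real n - 2)) \<partial>lborel) powr ((real n - 2) / real n)
      \<le> S * (\<integral>x. (norm (g x))\<^sup>2 \<partial>lborel)"
    by (rule sobolev_inequality[where 'a="real ^ 'n", unfolded dim, OF assms(2)]) (rule that; assumption)
  define D where "D = 225 * (S * (8 + (real n)\<^sup>2 / 4))"
  have D: "D > 0" using S by (simp add: D_def add_pos_nonneg)
  show ?thesis
  proof (intro exI[of _ "1 / (2 * D)"] conjI allI impI)
    show "1 / (2 * D) > 0" using D by simp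
    fix k :: 'n and R :: real and u :: "real ^ 'n \<Rightarrow> real"
    assume R: "R > 0" and u: "u \<in> test_functions (half_ball k R)"
    define K where "K = closure {x. u x \<noteq> 0}"
    have uK: "C1_supp K u (grad u)" unfolding K_def by (rule smooth_C1_supp[OF u])
    have KA: "K \<subseteq> half_ball k R" using u by (simp add: K_def test_functions_def)
    interpret half_ball_fun K "axis k 1" R u "grad u"
      by unfold_locales (use uK R KA in \<open>auto simp: half_ball_def inner_axis\<close>)
    have I: "(LINT x:half_ball k R|lborel. f x) = (\<integral>x. f x \<partial>lborel)" if "\<And>x. x \<notin> K \<Longrightarrow> f x = 0" for f :: "real ^ 'n \<Rightarrow> real"
      by (rule set_integral_supp[OF KA that])
    let ?Q = "\<integral>x. (1 / (1 + lr x)) powr ((2 * real n - 2) / (real n - 2)) * \<bar>u x\<bar> powr (2 * real n / (real n - 2)) \<partial>lborel"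
    have Q: "(LINT x:half_ball k R|lborel. X1 (norm x / R) powr ((2 * real n - 2) / (real n - 2))
         * \<bar>u x\<bar> powr (2 * real n / (real n - 2))) = ?Q"
    proof -
      have eq: "X1 (norm x / R) powr ((2 * real n - 2) / (real n - 2)) * \<bar>u x\<bar> powr (2 * real n / (real n - 2))
        = (1 / (1 + lr x)) powr ((2 * real n - 2) / (real n - 2)) * \<bar>u x\<bar> powr (2 * real n / (real n - 2))" for x
        by (cases "x \<in> K") (simp_all add: X1_lr C1_supp_zero[OF uK])
      have "(LINT x:half_ball k R|lborel. X1 (norm x / R) powr ((2 * real n - 2) / (real n - 2))
         * \<bar>u x\<bar> powr (2 * real n / (real n - 2)))
        = (\<integral>x. X1 (norm x / R) powr ((2 * real n - 2) / (real n - 2)) * \<bar>u x\<bar> powr (2 * real n / (real n - 2)) \<partial>lborel)"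
        by (rule I) (simp add: C1_supp_zero[OF uK])
      then show ?thesis by (simp only: eq)
    qed
    have "?Q powr ((real n - 2) / real n) \<le> D * hardy_energy"
      unfolding D_def
    proof (rule log_sobolev[OF _ _ S sob])
      show "real n = real DIM(real ^ 'n)" by (simp only: dim)
      show "real n \<ge> 3" using assms(2) by simp
    qed
    then have sob_le: "1 / (2 * D) * ?Q powr ((real n - 2) / real n) \<le> hardy_energy / 2"
      using D by (simp add: field_simps)
    have E: "hardy_energy = (\<integral>x. (norm (grad u x))\<^sup>2 \<partial>lborel) - (real n)\<^sup>2 / 4 * (\<integral>x. (u x)\<^sup>2 / (norm x)\<^sup>2 \<partial>lborel)"
      unfolding hardy_energy_def dim ..
    have arith: "a + b + c \<le> d" if "b \<le> h / 2" "c \<le> h / 2" "h = d - a" for a b c d h :: real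
      using that by linarith
    have ints: "(LINT x:half_ball k R|lborel. (norm (grad u x))\<^sup>2) = (\<integral>x. (norm (grad u x))\<^sup>2 \<partial>lborel)"
      "(LINT x:half_ball k R|lborel. (u x)\<^sup>2 / (norm x)\<^sup>2) = (\<integral>x. (u x)\<^sup>2 / (norm x)\<^sup>2 \<partial>lborel)"
      "(LINT x:half_ball k R|lborel. (u x)\<^sup>2 / norm x powr (3/2)) = (\<integral>x. (u x)\<^sup>2 / norm x powr (3/2) \<partial>lborel)"
      by (rule I; simp add: C1_supp_zero[OF uK] C1_supp_grad_zero[OF uK])+
    show "(LINT x:half_ball k R|lborel. (norm (grad u x))\<^sup>2) \<ge>
      (real n)\<^sup>2 / 4 * (LINT x:half_ball k R|lborel. (u x)\<^sup>2 / (norm x)\<^sup>2)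
      + 1 / (16 * R powr (1/2)) * (LINT x:half_ball k R|lborel. (u x)\<^sup>2 / norm x powr (3/2))
      + 1 / (2 * D) * (LINT x:half_ball k R|lborel.
               X1 (norm x / R) powr ((2 * real n - 2) / (real n - 2))
               * \<bar>u x\<bar> powr (2 * real n / (real n - 2)))
            powr ((real n - 2) / real n)"
      unfolding Q ints by (rule arith[OF remainder_le sob_le E])
  qed
qed

end
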